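(* Let $s\in\mathbb{N}$, $k\in\mathbb{Z}$, and let $n$ denote a positive integer. (i) For every $n\ge 1$, the worst case error of $A_n^{\rm QMC}$ is $$\tilde e(A_n^{\rm QMC})=\left(\sum_{j=1}^\infty\left(\frac1{\max\{1,(2\pi(jn+k))^{2s}\}}+\frac1{\max\{1,(2\pi(jn-k))^{2s}\}}\right)\right)^{1/2}.$$ (ii) For any $1\le n\le|k|$ we have $\tilde e(A_n^{\rm QMC})>\tilde e(0,k,s)$. (iii) For any $n>|k|$ we have $$\tilde e(A_n^{\rm QMC})=\left(\sum_{j=1}^\infty\left(\frac1{(2\pi(jn+k))^{2s}}+\frac1{(2\pi(jn-k))^{2s}}\right)\right)^{1/2}\le\frac{2}{(2\pi)^s}\,\frac1{(n-|k|)^s}.$$ (iv) Let $\alpha\in(0,1)$. Then for $n>\frac{1+\alpha}{1-\alpha}\,|k|$ we have $$\tilde e(A_n^{\rm QMC})<\frac{2}{(2\pi\alpha)^s}\,\frac1{(n+|k|)^s}.$$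
   Context: For $s\in\mathbb{N}=\{1,2,\dots\}$ let $H^s=\{f:[0,1]\to\mathbb{C} : f^{(s-1)}\text{ is absolutely continuous},\ f^{(s)}\in L_2([0,1])\}$ with inner product $$\langle f,g\rangle_s=\sum_{\ell=0}^{s-1}\int_0^1 f^{(\ell)}(x)\,dx\ \int_0^1\overline{g^{(\ell)}(x)}\,dx+\int_0^1 f^{(s)}(x)\,\overline{g^{(s)}(x)}\,dx$$ and norm $\|f\|_{H^s}=\langle f,f\rangle_s^{1/2}$. The periodic subspace is $\widetilde H^s=\{f\in H^s : f^{(\ell)}(0)=f^{(\ell)}(1)\text{ for }\ell=0,1,\dots,s-1\}$ with the same inner product. For $k\in\mathbb{Z}$, $I_k(f)=\int_0^1 f(x)\,e^{-2\pi i kx}\,dx$. For an algorithm $A:\widetilde H^s\to\mathbb{C}$ its worst case error is $\tilde e(A)=\sup\{|I_k(f)-A(f)| : f\in\widetilde H^s,\ \|f\|_{H^s}\le1\}$; the initial error is $\tilde e(0,k,s)=\sup\{|I_k(f)| : f\in\widetilde H^s,\ \|f\|_{H^s}\le 1\}$. For $n\ge1$, $$A_n^{\rm QMC}(f)=\frac1n\sum_{j=1}^n f(j/n)\,e^{-2\pi i k j/n},\qquad f\in\widetilde H^s.$$ *)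

theory Defs
  imports "HOL-Analysis.Analysis"
begin

text \<open>Absolute continuity of a function on an interval in the classical epsilon-delta sense.
  (The library constant \<^const>\<open>absolutely_continuous\<close> is about measures.)\<close>

definition abs_continuous_on :: "real set \<Rightarrow> (real \<Rightarrow> complex) \<Rightarrow> bool" where
  "abs_continuous_on S g \<longleftrightarrow>
     (\<forall>\<epsilon>>0. \<exists>\<delta>>0. \<forall>(m::nat) u v.
        (\<forall>i<m. u i \<le> v i \<and> {u i..v i} \<subseteq> S) \<longrightarrow>
        disjoint_family_on (\<lambda>i. {u i<..<v i}) {..<m} \<longrightarrow>
        (\<Sum>i<m. v i - u i) < \<delta> \<longrightarrow>
        (\<Sum>i<m. cmod (g (v i) - g (u i))) < \<epsilon>)"

text \<open>Derivatives are taken within \<open>{0..1}\<close>, hence one-sided at the end points. Where the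
  derivative does not exist, the value is unspecified.\<close>

definition deriv01 :: "nat \<Rightarrow> (real \<Rightarrow> complex) \<Rightarrow> real \<Rightarrow> complex" where
  "deriv01 l f = ((\<lambda>g x. vector_derivative g (at x within {0..1})) ^^ l) f"

definition L2_01 :: "(real \<Rightarrow> complex) set" where
  "L2_01 = {g. set_borel_measurable lebesgue {0..1} g \<and>
               set_integrable lebesgue {0..1} (\<lambda>x. (cmod (g x))\<^sup>2)}"

text \<open>Functions on \<open>[0,1]\<close> are represented by elements of \<open>{0..1} \<rightarrow>\<^sub>E UNIV\<close>, so that they are
  determined by their values on \<open>[0,1]\<close>. The almost everywhere differentiability of the derivative
  of order \<open>s - 1\<close> follows from its absolute continuity; it is listed because only then the total
  function \<open>deriv01 s f\<close> represents the almost everywhere defined s-th derivative.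
  Intended for \<open>s \<ge> 1\<close>.\<close>

definition sobolev :: "nat \<Rightarrow> (real \<Rightarrow> complex) set" where
  "sobolev s = {f \<in> {0..1} \<rightarrow>\<^sub>E UNIV.
     (\<forall>l<s - 1. \<forall>x\<in>{0..1}. deriv01 l f differentiable (at x within {0..1})) \<and>
     abs_continuous_on {0..1} (deriv01 (s - 1) f) \<and>
     (AE x in lebesgue. x \<in> {0..1} \<longrightarrow> deriv01 (s - 1) f differentiable (at x within {0..1})) \<and>
     deriv01 s f \<in> L2_01}"

definition sob_inner :: "nat \<Rightarrow> (real \<Rightarrow> complex) \<Rightarrow> (real \<Rightarrow> complex) \<Rightarrow> complex" where
  "sob_inner s f g =
     (\<Sum>l<s. (LINT x:{0..1}|lebesgue. deriv01 l f x) *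
             (LINT x:{0..1}|lebesgue. cnj (deriv01 l g x))) +
     (LINT x:{0..1}|lebesgue. deriv01 s f x * cnj (deriv01 s g x))"

text \<open>\<open>sob_inner s f f\<close> is real and nonnegative, so taking the real part loses nothing.\<close>

definition sob_norm :: "nat \<Rightarrow> (real \<Rightarrow> complex) \<Rightarrow> real" where
  "sob_norm s f = sqrt (Re (sob_inner s f f))"

definition periodic_sobolev :: "nat \<Rightarrow> (real \<Rightarrow> complex) set" where
  "periodic_sobolev s = {f \<in> sobolev s. \<forall>l<s. deriv01 l f 0 = deriv01 l f 1}"

definition fourier_int :: "int \<Rightarrow> (real \<Rightarrow> complex) \<Rightarrow> complex" where
  "fourier_int k f =
     (LINT x:{0..1}|lebesgue. f x * exp (- (2 * of_real pi * \<i> * of_int k * of_real x)))"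

definition periodic_ball :: "nat \<Rightarrow> (real \<Rightarrow> complex) set" where
  "periodic_ball s = {f \<in> periodic_sobolev s. sob_norm s f \<le> 1}"

text \<open>Suprema are taken in the extended reals, so that they are meaningful without a
  boundedness assumption.\<close>

definition wc_error :: "nat \<Rightarrow> int \<Rightarrow> ((real \<Rightarrow> complex) \<Rightarrow> complex) \<Rightarrow> ereal" where
  "wc_error s k A = (SUP f\<in>periodic_ball s. ereal (cmod (fourier_int k f - A f)))"

definition init_error :: "nat \<Rightarrow> int \<Rightarrow> ereal" where
  "init_error s k = (SUP f\<in>periodic_ball s. ereal (cmod (fourier_int k f)))"

definition qmc :: "nat \<Rightarrow> int \<Rightarrow> (real \<Rightarrow> complex) \<Rightarrow> complex" where
  "qmc n k f =
     1 / of_nat n * (\<Sum>j = 1..n. f (real j / real n) *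
       exp (- (2 * of_real pi * \<i> * of_int k * of_nat j / of_nat n)))"

end

theory Submission
  imports Defs
begin

text \<open>
  Write \<open>c h\<close> for the Fourier coefficients of a periodic \<open>f\<close> of smoothness \<open>s\<close>. Each
  differentiation multiplies \<open>c h\<close> by \<open>2 \<pi> \<i> h\<close>, and the derivatives of positive order have
  mean zero, so that the squared Sobolev norm is \<open>\<Sum>h. r h * |c h|^2\<close> with the weight
  \<open>r h = max 1 ((2 \<pi> h)^(2 s))\<close>. On the nodes \<open>j / n\<close> the exponentials of frequencies \<open>h\<close> and
  \<open>k\<close> coincide if \<open>n\<close> divides \<open>h - k\<close>, and they are orthogonal otherwise. Hence the quadrature
  formula returns the sum of \<open>c h\<close> over all aliases \<open>h\<close> of \<open>k\<close>, and its error is minus the sum over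
  the aliases other than \<open>k\<close>. By Cauchy-Schwarz the error on the unit ball is at most
  \<open>sqrt W\<close>, where \<open>W\<close> is the sum of \<open>1 / r h\<close> over these aliases (\<open>qmc_error_le\<close>). The
  function with coefficients \<open>c h = 1 / (r h * sqrt W)\<close> at these aliases attains the bound; its
  normalised truncations to finitely many aliases show sharpness (\<open>wc_error_qmc_ge\<close>). This gives
  the formula for the worst case error; the other claims compare its terms with \<open>1 / r k\<close> and with
  the series of inverse squares.

  The analytic point is that \<open>f\<close> is the pointwise limit of its symmetric Fourier partial sums
  (\<open>fourier_series_tendsto\<close>). Integration by parts represents \<open>f x\<close>, up to its mean, as the
  integral of \<open>f'\<close> against a sawtooth function of the integration variable with its jump at \<open>x\<close>.
  The partial sums of \<open>f\<close> arise in the same way from the partial sums of the sawtooth, so by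
  Cauchy-Schwarz it suffices that the latter converge in the quadratic mean. This is the case
  because the squared Fourier coefficients of the sawtooth add up to its squared norm \<open>1/12\<close>, by
  \<open>\<Sum>j. 1 / j^2 = \<pi>^2 / 6\<close>.

  The integration by parts rests on the fundamental theorem of calculus for absolutely continuous
  functions (\<open>abs_continuous_on_has_integral\<close>). Since differentiability almost everywhere
  is part of the definition of the Sobolev space, this is a direct argument with gauges.
\<close>

section \<open>Absolutely continuous functions\<close>

text \<open>The definition speaks of families indexed by an initial segment of the naturals. Tagged
  divisions are families indexed by their own elements, and this form applies to them directly.\<close>

lemma abs_continuous_on_finite_familyD:
  assumes "abs_continuous_on S g" "\<epsilon> > 0"
  shows "\<exists>\<delta>>0. \<forall>(P::'i set) u v. finite P \<longrightarrow> (\<forall>i\<in>P. u i \<le> v i \<and> {u i..v i} \<subseteq> S) \<longrightarrow>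
    disjoint_family_on (\<lambda>i. {u i<..<v i}) P \<longrightarrow> (\<Sum>i\<in>P. v i - u i) < \<delta> \<longrightarrow>
    (\<Sum>i\<in>P. cmod (g (v i) - g (u i))) < \<epsilon>"
proof -
  from assms obtain \<delta> where \<delta>: "\<delta> > 0"
    and D: "\<And>(m::nat) u v. \<lbrakk>\<forall>i<m. u i \<le> v i \<and> {u i..v i} \<subseteq> S;
        disjoint_family_on (\<lambda>i. {u i<..<v i}) {..<m}; (\<Sum>i<m. v i - u i) < \<delta>\<rbrakk>
      \<Longrightarrow> (\<Sum>i<m. cmod (g (v i) - g (u i))) < \<epsilon>"
    unfolding abs_continuous_on_def by blast
  have "(\<Sum>i\<in>P. cmod (g (v i) - g (u i))) < \<epsilon>"
    if P: "finite P" and le: "\<forall>i\<in>P. u i \<le> v i \<and> {u i..v i} \<subseteq> S"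
      and disj: "disjoint_family_on (\<lambda>i. {u i<..<v i}) P" and s: "(\<Sum>i\<in>P. v i - u i) < \<delta>"
    for P :: "'i set" and u v
  proof -
    obtain h where h: "bij_betw h {..<card P} P"
      using ex_bij_betw_nat_finite[OF P] by (auto simp: atLeast0LessThan)
    then have hP: "\<And>i. i < card P \<Longrightarrow> h i \<in> P"
      by (auto simp: bij_betw_def)
    have "(\<Sum>i<card P. cmod (g (v (h i)) - g (u (h i)))) < \<epsilon>"
    proof (rule D)
      show "\<forall>i<card P. u (h i) \<le> v (h i) \<and> {u (h i)..v (h i)} \<subseteq> S"
        using hP le by blast
      show "disjoint_family_on (\<lambda>i. {u (h i)<..<v (h i)}) {..<card P}"
        using disj h unfolding disjoint_family_on_def bij_betw_def inj_on_def
        by (metis lessThan_iff hP)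
      show "(\<Sum>i<card P. v (h i) - u (h i)) < \<delta>"
        using s sum.reindex_bij_betw[OF h, of "\<lambda>i. v i - u i"] by simp
    qed
    then show ?thesis
      using sum.reindex_bij_betw[OF h, of "\<lambda>i. cmod (g (v i) - g (u i))"] by simp
  qed
  with \<delta> show ?thesis by blast
qed

lemma abs_continuous_on_subset:
  assumes "abs_continuous_on S g" "T \<subseteq> S"
  shows "abs_continuous_on T g"
  unfolding abs_continuous_on_def
proof (intro allI impI)
  fix \<epsilon> :: real assume "\<epsilon> > 0"
  then obtain \<delta> where "\<delta> > 0" and D: "\<And>(m::nat) u v. \<lbrakk>\<forall>i<m. u i \<le> v i \<and> {u i..v i} \<subseteq> S;
        disjoint_family_on (\<lambda>i. {u i<..<v i}) {..<m}; (\<Sum>i<m. v i - u i) < \<delta>\<rbrakk>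
      \<Longrightarrow> (\<Sum>i<m. cmod (g (v i) - g (u i))) < \<epsilon>"
    using assms(1) unfolding abs_continuous_on_def by blast
  then show "\<exists>\<delta>>0. \<forall>(m::nat) u v. (\<forall>i<m. u i \<le> v i \<and> {u i..v i} \<subseteq> T) \<longrightarrow>
        disjoint_family_on (\<lambda>i. {u i<..<v i}) {..<m} \<longrightarrow>
        (\<Sum>i<m. v i - u i) < \<delta> \<longrightarrow> (\<Sum>i<m. cmod (g (v i) - g (u i))) < \<epsilon>"
    by (intro exI[of _ \<delta>] conjI allI impI D) (use order_trans[OF _ assms(2)] in simp_all)
qed

lemma abs_continuous_on_imp_continuous_on:
  assumes "abs_continuous_on {a..b} g"
  shows "continuous_on {a..b} g"
  unfolding continuous_on_iff
proof (intro ballI allI impI)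
  fix x \<epsilon> :: real
  assume x: "x \<in> {a..b}" and \<epsilon>: "0 < \<epsilon>"
  obtain \<delta> where \<delta>: "\<delta> > 0"
    and D0: "\<forall>(P::unit set) u v. finite P \<longrightarrow> (\<forall>i\<in>P. u i \<le> v i \<and> {u i..v i} \<subseteq> {a..b}) \<longrightarrow>
      disjoint_family_on (\<lambda>i. {u i<..<v i}) P \<longrightarrow> (\<Sum>i\<in>P. v i - u i) < \<delta> \<longrightarrow>
      (\<Sum>i\<in>P. cmod (g (v i) - g (u i))) < \<epsilon>"
    using abs_continuous_on_finite_familyD[OF assms \<epsilon>, where 'i=unit] by blast
  have D: "cmod (g y - g x) < \<epsilon>" if "x \<le> y" "{x..y} \<subseteq> {a..b}" "y - x < \<delta>" for x y
    using D0[rule_format, of "{()}" "\<lambda>_. x" "\<lambda>_. y"] that by (simp add: disjoint_family_on_def)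
  have "dist (g y) (g x) < \<epsilon>" if y: "y \<in> {a..b}" "dist y x < \<delta>" for y
  proof (cases "x \<le> y")
    case True
    then show ?thesis using D[of x y] x y by (simp add: dist_norm)
  next
    case False
    then show ?thesis using D[of y x] x y by (simp add: dist_norm norm_minus_commute)
  qed
  with \<delta> show "\<exists>d>0. \<forall>x'\<in>{a..b}. dist x' x < d \<longrightarrow> dist (g x') (g x) < \<epsilon>"
    by blast
qed

lemma Lipschitz_imp_abs_continuous_on:
  assumes L: "\<And>x y. \<lbrakk>x \<in> S; y \<in> S\<rbrakk> \<Longrightarrow> cmod (g y - g x) \<le> L * \<bar>y - x\<bar>"
  shows "abs_continuous_on S g"
  unfolding abs_continuous_on_def
proof (intro allI impI)
  fix \<epsilon> :: real assume \<epsilon>: "0 < \<epsilon>"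
  show "\<exists>\<delta>>0. \<forall>(m::nat) u v. (\<forall>i<m. u i \<le> v i \<and> {u i..v i} \<subseteq> S) \<longrightarrow>
        disjoint_family_on (\<lambda>i. {u i<..<v i}) {..<m} \<longrightarrow>
        (\<Sum>i<m. v i - u i) < \<delta> \<longrightarrow> (\<Sum>i<m. cmod (g (v i) - g (u i))) < \<epsilon>"
  proof (intro exI[of _ "\<epsilon> / (\<bar>L\<bar> + 1)"] conjI allI impI)
    fix m :: nat and u v
    assume uv: "\<forall>i<m. u i \<le> v i \<and> {u i..v i} \<subseteq> S" and s: "(\<Sum>i<m. v i - u i) < \<epsilon> / (\<bar>L\<bar> + 1)"
    have "(\<Sum>i<m. cmod (g (v i) - g (u i))) \<le> (\<Sum>i<m. (\<bar>L\<bar> + 1) * (v i - u i))"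
    proof (rule sum_mono)
      fix i assume "i \<in> {..<m}"
      then have "u i \<le> v i" "{u i..v i} \<subseteq> S" using uv by simp_all
      then have i: "u i \<le> v i" "u i \<in> S" "v i \<in> S" by fastforce+
      then have "cmod (g (v i) - g (u i)) \<le> L * (v i - u i)" using L[of "u i" "v i"] by simp
      also have "\<dots> \<le> (\<bar>L\<bar> + 1) * (v i - u i)" using i by (intro mult_right_mono) auto
      finally show "cmod (g (v i) - g (u i)) \<le> (\<bar>L\<bar> + 1) * (v i - u i)" .
    qed
    also have "\<dots> = (\<bar>L\<bar> + 1) * (\<Sum>i<m. v i - u i)" by (simp add: sum_distrib_left)
    also have "\<dots> < \<epsilon>" using s by (simp add: field_simps)
    finally show "(\<Sum>i<m. cmod (g (v i) - g (u i))) < \<epsilon>" .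
  qed (use \<epsilon> in simp)
qed

lemma C1_imp_abs_continuous_on:
  assumes g: "\<And>x. x \<in> {a..b} \<Longrightarrow> (g has_vector_derivative g' x) (at x within {a..b})"
    and g': "continuous_on {a..b} g'"
  shows "abs_continuous_on {a..b} g"
proof -
  have "bounded (g' ` {a..b})"
    using compact_continuous_image[OF g'] by (simp add: compact_imp_bounded)
  then obtain L where L: "\<And>x. x \<in> {a..b} \<Longrightarrow> cmod (g' x) \<le> L"
    unfolding bounded_iff by blast
  show ?thesis
  proof (rule Lipschitz_imp_abs_continuous_on)
    fix x y assume xy: "x \<in> {a..b}" "y \<in> {a..b}"
    have "norm (g y - g x) \<le> L * norm (y - x)"
    proof (rule differentiable_bound[of "{a..b}" g "\<lambda>x h. h *\<^sub>R g' x"])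
      show "onorm (\<lambda>h. h *\<^sub>R g' z) \<le> L" if "z \<in> {a..b}" for z
        using L[OF that] by (intro onorm_bound) (simp_all add: mult.commute[of L] mult_left_mono order_trans[OF norm_ge_zero])
    qed (use g xy in \<open>auto simp: has_vector_derivative_def\<close>)
    then show "cmod (g y - g x) \<le> L * \<bar>y - x\<bar>" by simp
  qed
qed

lemma abs_continuous_on_mult:
  assumes f: "abs_continuous_on {a..b} f" and g: "abs_continuous_on {a..b} g"
  shows "abs_continuous_on {a..b} (\<lambda>x. f x * g x)"
proof -
  have "bounded (h ` {a..b})" if "abs_continuous_on {a..b} h" for h
    using compact_continuous_image[OF abs_continuous_on_imp_continuous_on[OF that]]
    by (simp add: compact_imp_bounded)
  then obtain F0 G0 where F0: "\<And>x. x \<in> {a..b} \<Longrightarrow> cmod (f x) \<le> F0"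
    and G0: "\<And>x. x \<in> {a..b} \<Longrightarrow> cmod (g x) \<le> G0"
    using f g unfolding bounded_iff by (metis imageI)
  define B where "B = \<bar>F0\<bar> + \<bar>G0\<bar> + 1"
  have B: "B > 0" "\<And>x. x \<in> {a..b} \<Longrightarrow> cmod (f x) \<le> B" "\<And>x. x \<in> {a..b} \<Longrightarrow> cmod (g x) \<le> B"
    using F0 G0 by (force simp: B_def)+
  show ?thesis
    unfolding abs_continuous_on_def
  proof (intro allI impI)
    fix \<epsilon> :: real assume "0 < \<epsilon>"
    then have e: "\<epsilon> / (2 * B) > 0" using B by simp
    obtain \<delta>1 where d1: "\<delta>1 > 0"
      and D1: "\<forall>(P::nat set) u v. finite P \<longrightarrow> (\<forall>i\<in>P. u i \<le> v i \<and> {u i..v i} \<subseteq> {a..b}) \<longrightarrow>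
        disjoint_family_on (\<lambda>i. {u i<..<v i}) P \<longrightarrow> (\<Sum>i\<in>P. v i - u i) < \<delta>1 \<longrightarrow>
          (\<Sum>i\<in>P. cmod (f (v i) - f (u i))) < \<epsilon> / (2 * B)"
      using abs_continuous_on_finite_familyD[OF f e, where 'i=nat] by blast
    obtain \<delta>2 where d2: "\<delta>2 > 0"
      and D2: "\<forall>(P::nat set) u v. finite P \<longrightarrow> (\<forall>i\<in>P. u i \<le> v i \<and> {u i..v i} \<subseteq> {a..b}) \<longrightarrow>
        disjoint_family_on (\<lambda>i. {u i<..<v i}) P \<longrightarrow> (\<Sum>i\<in>P. v i - u i) < \<delta>2 \<longrightarrow>
          (\<Sum>i\<in>P. cmod (g (v i) - g (u i))) < \<epsilon> / (2 * B)"
      using abs_continuous_on_finite_familyD[OF g e, where 'i=nat] by blast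
    show "\<exists>\<delta>>0. \<forall>(m::nat) u v. (\<forall>i<m. u i \<le> v i \<and> {u i..v i} \<subseteq> {a..b}) \<longrightarrow>
        disjoint_family_on (\<lambda>i. {u i<..<v i}) {..<m} \<longrightarrow> (\<Sum>i<m. v i - u i) < \<delta> \<longrightarrow>
        (\<Sum>i<m. cmod (f (v i) * g (v i) - f (u i) * g (u i))) < \<epsilon>"
    proof (intro exI[of _ "min \<delta>1 \<delta>2"] conjI allI impI)
      fix m :: nat and u v
      assume uv: "\<forall>i<m. u i \<le> v i \<and> {u i..v i} \<subseteq> {a..b}"
        and disj: "disjoint_family_on (\<lambda>i. {u i<..<v i}) {..<m}"
        and s: "(\<Sum>i<m. v i - u i) < min \<delta>1 \<delta>2"
      have "(\<Sum>i<m. cmod (f (v i) * g (v i) - f (u i) * g (u i)))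
         \<le> (\<Sum>i<m. B * cmod (g (v i) - g (u i)) + B * cmod (f (v i) - f (u i)))"
      proof (rule sum_mono)
        fix i assume "i \<in> {..<m}"
        then have "u i \<le> v i" "{u i..v i} \<subseteq> {a..b}" using uv by simp_all
        then have i: "u i \<in> {a..b}" "v i \<in> {a..b}" by fastforce+
        have "f (v i) * g (v i) - f (u i) * g (u i)
            = f (v i) * (g (v i) - g (u i)) + g (u i) * (f (v i) - f (u i))"
          by (simp add: algebra_simps)
        then have "cmod (f (v i) * g (v i) - f (u i) * g (u i))
            \<le> cmod (f (v i)) * cmod (g (v i) - g (u i)) + cmod (g (u i)) * cmod (f (v i) - f (u i))"
          by (metis norm_mult norm_triangle_ineq)
        also have "\<dots> \<le> B * cmod (g (v i) - g (u i)) + B * cmod (f (v i) - f (u i))"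
          using B i by (intro add_mono mult_right_mono) auto
        finally show "cmod (f (v i) * g (v i) - f (u i) * g (u i))
            \<le> B * cmod (g (v i) - g (u i)) + B * cmod (f (v i) - f (u i))" .
      qed
      also have "\<dots> = B * (\<Sum>i<m. cmod (g (v i) - g (u i))) + B * (\<Sum>i<m. cmod (f (v i) - f (u i)))"
        by (simp add: sum.distrib sum_distrib_left)
      also have "\<dots> < B * (\<epsilon> / (2 * B)) + B * (\<epsilon> / (2 * B))"
        using uv disj s B(1)
        by (intro add_strict_mono mult_strict_left_mono D1[rule_format] D2[rule_format]) auto
      also have "\<dots> = \<epsilon>" using B by simp
      finally show "(\<Sum>i<m. cmod (f (v i) * g (v i) - f (u i) * g (u i))) < \<epsilon>" .
    qed (use d1 d2 in simp)
  qed
qed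

text \<open>Tags outside the exceptional set \<open>N\<close> are treated as in the classical fundamental theorem. At
  tags in \<open>N\<close> the integrand may be set to 0, and the gauge is an open superset of \<open>N\<close> of small
  measure: the intervals of a fine division that are tagged in \<open>N\<close> then have small total length,
  and absolute continuity bounds the increments of \<open>g\<close> over them.\<close>

lemma abs_continuous_on_has_integral:
  assumes "a \<le> b" and AC: "abs_continuous_on {a..b} g" and N: "negligible N"
    and g': "\<And>x. x \<in> {a..b} - N \<Longrightarrow> (g has_vector_derivative g' x) (at x within {a..b})"
  shows "(g' has_integral (g b - g a)) {a..b}"
proof -
  define h where "h x = (if x \<in> N then 0 else g' x)" for x
  have "(h has_integral (g b - g a)) {a..b}"
    unfolding has_integral_real
  proof (intro allI impI)
    fix \<epsilon> :: real assume \<epsilon>: "0 < \<epsilon>"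
    \<comment> \<open>Half of \<open>\<epsilon>\<close> is spent on the tags in \<open>N\<close>. The other half is distributed in
      proportion to length; the summand 1 avoids a zero denominator for \<open>a = b\<close>.\<close>
    define e where "e = \<epsilon> / (2 * (b - a + 1))"
    have e: "e > 0" using \<epsilon> \<open>a \<le> b\<close> by (simp add: e_def)
    obtain \<delta> where \<delta>: "\<delta> > 0"
      and D: "\<forall>(P::(real \<times> real set) set) u v. finite P \<longrightarrow> (\<forall>i\<in>P. u i \<le> v i \<and> {u i..v i} \<subseteq> {a..b}) \<longrightarrow>
          disjoint_family_on (\<lambda>i. {u i<..<v i}) P \<longrightarrow> (\<Sum>i\<in>P. v i - u i) < \<delta> \<longrightarrow>
          (\<Sum>i\<in>P. cmod (g (v i) - g (u i))) < \<epsilon> / 2"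
      using abs_continuous_on_finite_familyD[OF AC half_gt_zero[OF \<epsilon>], where 'i="real \<times> real set"] by blast
    have N0: "N \<in> null_sets lebesgue" using N by (simp add: negligible_iff_null_sets)
    obtain U where U: "open U" "N \<subseteq> U" "emeasure lebesgue (U - N) < ennreal \<delta>"
      using sets_lebesgue_outer_open[of N \<delta>] N0 \<delta> by blast
    have Um: "emeasure lebesgue U < ennreal \<delta>"
      using U(3) emeasure_Diff_null_set[OF N0, of U] U(1) by (simp add: borel_open)
    have "\<forall>x. \<exists>d>0. x \<in> {a..b} - N \<longrightarrow>
         (\<forall>y\<in>{a..b}. norm (y-x) < d \<longrightarrow> norm (g y - g x - (y-x) *\<^sub>R g' x) \<le> e * norm (y-x))"
      using g' e unfolding has_vector_derivative_def has_derivative_within_alt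
      by (metis zero_less_one)
    then obtain d where d: "\<And>x. 0 < d x"
        "\<And>x y. \<lbrakk>x \<in> {a..b} - N; y \<in> {a..b}; norm (y-x) < d x\<rbrakk>
          \<Longrightarrow> norm (g y - g x - (y-x) *\<^sub>R g' x) \<le> e * norm (y-x)"
      by metis
    define \<gamma> where "\<gamma> x = (if x \<in> N then U else ball x (d x))" for x
    have \<gamma>: "gauge \<gamma>" using U d(1) by (auto simp: gauge_def \<gamma>_def)
    have "norm ((\<Sum>(x,K)\<in>p. measure lborel K *\<^sub>R h x) - (g b - g a)) < \<epsilon>"
      if p: "p tagged_division_of {a..b}" and fine: "\<gamma> fine p" for p
    proof -
      have fin: "finite p" using p by auto
      have K: "K = {Inf K..Sup K} \<and> Inf K \<le> x \<and> x \<le> Sup K \<and> K \<subseteq> {a..b} \<and> K \<subseteq> \<gamma> x"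
        if xK: "(x, K) \<in> p" for x K
      proof -
        have x: "x \<in> K" "K \<subseteq> {a..b}" using tagged_division_ofD[OF p] xK by blast+
        obtain u v where "K = cbox u v" using tagged_division_ofD(4)[OF p xK] by blast
        moreover from this x have "u \<le> v" by auto
        ultimately show ?thesis using x fine xK by (auto simp: fine_def)
      qed
      have len: "Inf (snd q) \<le> Sup (snd q)" "{Inf (snd q)..Sup (snd q)} \<subseteq> {a..b}" if "q \<in> p" for q
      proof -
        have "(fst q, snd q) \<in> p" using that by simp
        note K = K[OF this]
        show "Inf (snd q) \<le> Sup (snd q)" using K by linarith
        show "{Inf (snd q)..Sup (snd q)} \<subseteq> {a..b}" using K by simp
      qed
      let ?D = "\<lambda>(x,K). measure lborel K *\<^sub>R h x - (g (Sup K) - g (Inf K))"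
      let ?A = "{q \<in> p. fst q \<in> N}" and ?B = "{q \<in> p. fst q \<notin> N}"
      have "(\<Sum>q\<in>?A. norm (?D q)) = (\<Sum>q\<in>?A. cmod (g (Sup (snd q)) - g (Inf (snd q))))"
        by (intro sum.cong) (auto simp: h_def norm_minus_commute)
      also have "\<dots> < \<epsilon> / 2"
      proof (rule D[rule_format])
        show "disjoint_family_on (\<lambda>q. {Inf (snd q)<..<Sup (snd q)}) ?A"
          unfolding disjoint_family_on_def
        proof (intro ballI impI)
          fix q r assume qr: "q \<in> ?A" "r \<in> ?A" "q \<noteq> r"
          then have "interior (snd q) \<inter> interior (snd r) = {}"
            using tagged_division_ofD(5)[OF p, of "fst q" "snd q" "fst r" "snd r"]
            by (auto simp: prod_eq_iff)
          moreover have "interior (snd t) = {Inf (snd t)<..<Sup (snd t)}" if "t \<in> ?A" for t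
            using K[of "fst t" "snd t"] that
            by (metis (no_types, lifting) interior_atLeastAtMost_real mem_Collect_eq prod.collapse)
          ultimately show "{Inf (snd q)<..<Sup (snd q)} \<inter> {Inf (snd r)<..<Sup (snd r)} = {}"
            using qr by simp
        qed
        then have "(\<Sum>q\<in>?A. emeasure lebesgue {Inf (snd q)<..<Sup (snd q)})
            = emeasure lebesgue (\<Union>q\<in>?A. {Inf (snd q)<..<Sup (snd q)})"
          using fin by (intro sum_emeasure) auto
        also have "\<dots> \<le> emeasure lebesgue U"
        proof (rule emeasure_mono)
          show "(\<Union>q\<in>?A. {Inf (snd q)<..<Sup (snd q)}) \<subseteq> U"
          proof
            fix y assume "y \<in> (\<Union>q\<in>?A. {Inf (snd q)<..<Sup (snd q)})"
            then obtain x L where xL: "(x, L) \<in> p" "x \<in> N" "Inf L < y" "y < Sup L" by auto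
            then have "y \<in> L" using K[of x L] by (metis atLeastAtMost_iff less_imp_le)
            then show "y \<in> U" using K[of x L] xL by (auto simp: \<gamma>_def)
          qed
        qed (use U in \<open>simp add: borel_open\<close>)
        also note Um
        also have "(\<Sum>q\<in>?A. emeasure lebesgue {Inf (snd q)<..<Sup (snd q)})
            = (\<Sum>q\<in>?A. ennreal (Sup (snd q) - Inf (snd q)))"
          using len by (intro sum.cong) simp_all
        also have "\<dots> = ennreal (\<Sum>q\<in>?A. Sup (snd q) - Inf (snd q))"
          using len by (intro sum_ennreal) simp
        finally show "(\<Sum>q\<in>?A. Sup (snd q) - Inf (snd q)) < \<delta>"
          using len(1) by (subst (asm) ennreal_less_iff) (auto intro!: sum_nonneg)
        show "Inf (snd q) \<le> Sup (snd q) \<and> {Inf (snd q)..Sup (snd q)} \<subseteq> {a..b}"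
          if "q \<in> ?A" for q
          using len that by simp
      qed (use fin in simp)
      finally have A: "(\<Sum>q\<in>?A. norm (?D q)) < \<epsilon> / 2" .
      have "(\<Sum>q\<in>?B. norm (?D q)) \<le> (\<Sum>q\<in>?B. e * (Sup (snd q) - Inf (snd q)))"
      proof (rule sum_mono)
        fix q assume q: "q \<in> ?B"
        obtain x L where xL: "q = (x, L)" by (cases q)
        define u v where "u = Inf L" and "v = Sup L"
        have L: "L = {u..v}" "u \<le> x" "x \<le> v" "L \<subseteq> {a..b}" "L \<subseteq> ball x (d x)" "x \<notin> N"
          using K[of x L] q xL by (auto simp: u_def v_def \<gamma>_def)
        have uv: "u \<in> {a..b}" "v \<in> {a..b}" "x \<in> {a..b} - N" "norm (u - x) < d x" "norm (v - x) < d x"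
          using L(2-4,6) subsetD[OF L(5), of u] subsetD[OF L(5), of v]
          by (auto simp: L(1) dist_real_def)
        have "norm ((v - u) *\<^sub>R g' x - (g v - g u))
            = norm (g u - g x - (u - x) *\<^sub>R g' x - (g v - g x - (v - x) *\<^sub>R g' x))"
          by (auto simp: algebra_simps)
        also have "\<dots> \<le> norm (g u - g x - (u - x) *\<^sub>R g' x) + norm (g v - g x - (v - x) *\<^sub>R g' x)"
          by (rule norm_triangle_ineq4)
        also have "\<dots> \<le> e * norm (u - x) + e * norm (v - x)"
          using uv by (intro add_mono d)
        also have "\<dots> = e * (v - u)" using L by (simp add: algebra_simps)
        finally show "norm (?D q) \<le> e * (Sup (snd q) - Inf (snd q))"
          using L by (simp add: xL h_def)
      qed
      also have "\<dots> \<le> (\<Sum>q\<in>p. e * (Sup (snd q) - Inf (snd q)))"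
        using len e fin by (intro sum_mono2) simp_all
      also have "\<dots> = e * (b - a)"
        using additive_tagged_division_1[OF \<open>a \<le> b\<close> p, of "\<lambda>x. x"]
        by (simp add: sum_distrib_left[symmetric] case_prod_unfold)
      also have "\<dots> \<le> \<epsilon> / 2" using \<open>a \<le> b\<close> \<epsilon> by (simp add: e_def field_simps)
      finally have B: "(\<Sum>q\<in>?B. norm (?D q)) \<le> \<epsilon> / 2" .
      have "(\<Sum>(x,K)\<in>p. measure lborel K *\<^sub>R h x) - (g b - g a) = (\<Sum>q\<in>p. ?D q)"
        using additive_tagged_division_1[OF \<open>a \<le> b\<close> p, of g]
        by (simp add: sum_subtractf case_prod_unfold)
      also have "norm \<dots> \<le> (\<Sum>q\<in>p. norm (?D q))" by (rule norm_sum)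
      also have "\<dots> = (\<Sum>q\<in>?A. norm (?D q)) + (\<Sum>q\<in>?B. norm (?D q))"
        using fin by (subst sum.union_disjoint[symmetric]) (auto intro!: sum.cong)
      finally show ?thesis using A B by linarith
    qed
    then show "\<exists>\<gamma>. gauge \<gamma> \<and> (\<forall>\<D>. \<D> tagged_division_of {a..b} \<and> \<gamma> fine \<D> \<longrightarrow>
        norm ((\<Sum>(x, k)\<in>\<D>. measure lborel k *\<^sub>R h x) - (g b - g a)) < \<epsilon>)"
      using \<gamma> by (intro exI[of _ \<gamma>]) simp
  qed
  moreover have "g' x = h x" if "x \<in> {a..b} - N" for x using that by (simp add: h_def)
  ultimately show ?thesis by (intro has_integral_spike[OF N, of _ g' h])
qed

section \<open>Square integrable functions and the Bessel identity\<close>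

definition square_integrable :: "'a measure \<Rightarrow> ('a \<Rightarrow> complex) \<Rightarrow> bool" where
  "square_integrable M f \<longleftrightarrow> f \<in> borel_measurable M \<and> integrable M (\<lambda>x. (cmod (f x))\<^sup>2)"

lemma square_integrableD: "square_integrable M f \<Longrightarrow> f \<in> borel_measurable M"
  by (simp add: square_integrable_def)

lemma borel_measurable_cnj [measurable (raw)]:
  "f \<in> borel_measurable M \<Longrightarrow> (\<lambda>x. cnj (f x)) \<in> borel_measurable M"
  by (rule borel_measurable_continuous_onI[THEN measurable_compose_rev]) (intro continuous_intros)

lemma square_integrable_norm_mult:
  assumes "square_integrable M f" "square_integrable M g"
  shows "integrable M (\<lambda>x. cmod (f x) * cmod (g x))"
proof (rule Bochner_Integration.integrable_bound)
  show "integrable M (\<lambda>x. (cmod (f x))\<^sup>2 + (cmod (g x))\<^sup>2)"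
    using assms by (simp add: square_integrable_def)
  show "(\<lambda>x. cmod (f x) * cmod (g x)) \<in> borel_measurable M"
    using assms[THEN square_integrableD] by measurable
  have "a * b \<le> a\<^sup>2 + b\<^sup>2" if "a \<ge> 0" "b \<ge> 0" for a b :: real
    using sum_squares_bound[of a b] mult_nonneg_nonneg[OF that] by linarith
  then show "AE x in M. norm (cmod (f x) * cmod (g x)) \<le> norm ((cmod (f x))\<^sup>2 + (cmod (g x))\<^sup>2)"
    by (intro AE_I2) (simp add: abs_mult)
qed

lemma square_integrable_mult:
  assumes "square_integrable M f" "square_integrable M g"
  shows "integrable M (\<lambda>x. f x * g x)"
proof (rule Bochner_Integration.integrable_bound[OF square_integrable_norm_mult[OF assms]])
  show "(\<lambda>x. f x * g x) \<in> borel_measurable M"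
    using assms[THEN square_integrableD] by measurable
qed (simp add: norm_mult)

lemma square_integrable_cnj: "square_integrable M f \<Longrightarrow> square_integrable M (\<lambda>x. cnj (f x))"
  by (simp add: square_integrable_def borel_measurable_cnj)

lemma square_integrable_cmult: "square_integrable M f \<Longrightarrow> square_integrable M (\<lambda>x. c * f x)"
  by (simp add: square_integrable_def norm_mult power_mult_distrib borel_measurable_times)

lemma square_integrable_add:
  assumes f: "square_integrable M f" and g: "square_integrable M g"
  shows "square_integrable M (\<lambda>x. f x + g x)"
proof -
  have "integrable M (\<lambda>x. (cmod (f x + g x))\<^sup>2)"
  proof (rule Bochner_Integration.integrable_bound)
    show "integrable M (\<lambda>x. (cmod (f x))\<^sup>2 + (cmod (g x))\<^sup>2 + 2 * (cmod (f x) * cmod (g x)))"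
      using assms square_integrable_norm_mult[OF assms] by (simp add: square_integrable_def)
    show "(\<lambda>x. (cmod (f x + g x))\<^sup>2) \<in> borel_measurable M"
      using f[THEN square_integrableD] g[THEN square_integrableD] by measurable
    have "(cmod (f x + g x))\<^sup>2 \<le> (cmod (f x) + cmod (g x))\<^sup>2" for x
      by (intro power_mono norm_triangle_ineq) simp
    then show "AE x in M. norm ((cmod (f x + g x))\<^sup>2)
        \<le> norm ((cmod (f x))\<^sup>2 + (cmod (g x))\<^sup>2 + 2 * (cmod (f x) * cmod (g x)))"
      by (intro AE_I2) (simp add: power2_sum mult.assoc)
  qed
  then show ?thesis using assms by (simp add: square_integrable_def borel_measurable_add)
qed

lemma square_integrable_diff:
  assumes "square_integrable M f" "square_integrable M g"
  shows "square_integrable M (\<lambda>x. f x - g x)"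
  using square_integrable_add[OF assms(1) square_integrable_cmult[OF assms(2), of "-1"]] by simp

lemma square_integrable_sum:
  assumes "\<And>i. i \<in> H \<Longrightarrow> square_integrable M (u i)"
  shows "square_integrable M (\<lambda>x. \<Sum>i\<in>H. u i x)"
  using assms
proof (induction H rule: infinite_finite_induct)
  case (insert i H)
  then show ?case using square_integrable_add[of M "u i" "\<lambda>x. \<Sum>i\<in>H. u i x"] by simp
qed (auto simp: square_integrable_def)

text \<open>The integral of \<open>(|f| - t |g|)^2\<close> is a quadratic polynomial in \<open>t\<close> without negative values.\<close>

lemma complex_integral_Cauchy_Schwarz:
  assumes f: "square_integrable M f" and g: "square_integrable M g"
  shows "(cmod (LINT x|M. f x * g x))\<^sup>2 \<le> (LINT x|M. (cmod (f x))\<^sup>2) * (LINT x|M. (cmod (g x))\<^sup>2)"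
proof -
  define A B C where "A = (LINT x|M. (cmod (f x))\<^sup>2)" and "B = (LINT x|M. (cmod (g x))\<^sup>2)"
    and "C = (LINT x|M. cmod (f x) * cmod (g x))"
  have i: "integrable M (\<lambda>x. (cmod (f x))\<^sup>2)" "integrable M (\<lambda>x. (cmod (g x))\<^sup>2)"
    "integrable M (\<lambda>x. cmod (f x) * cmod (g x))"
    using f g square_integrable_norm_mult[OF f g] by (simp_all add: square_integrable_def)
  have ge: "0 \<le> A - 2 * t * C + t\<^sup>2 * B" for t
  proof -
    have "0 \<le> (LINT x|M. (cmod (f x) - t * cmod (g x))\<^sup>2)" by simp
    also have "\<dots> = (LINT x|M. (cmod (f x))\<^sup>2 - (2 * t) * (cmod (f x) * cmod (g x)) + t\<^sup>2 * (cmod (g x))\<^sup>2)"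
      by (intro Bochner_Integration.integral_cong) (auto simp: power2_diff power_mult_distrib algebra_simps)
    also have "\<dots> = A - (2 * t) * C + t\<^sup>2 * B"
      using i by (simp add: A_def B_def C_def)
    finally show ?thesis by simp
  qed
  have "B \<ge> 0" "C \<ge> 0" by (simp_all add: B_def C_def)
  have "C\<^sup>2 \<le> A * B"
  proof (cases "B = 0")
    case True
    \<comment> \<open>If \<open>C\<close> were positive, the linear polynomial \<open>A - 2 t C\<close> would be \<open>- 1\<close> at this \<open>t\<close>.\<close>
    then have "C = 0" using ge[of "(A + 1) / (2 * C)"] by (cases "C = 0") auto
    then show ?thesis using True by simp
  next
    case False
    then have "B > 0" using \<open>B \<ge> 0\<close> by simp
    then show ?thesis using ge[of "C / B"] by (simp add: field_simps power2_eq_square)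
  qed
  moreover have "cmod (LINT x|M. f x * g x) \<le> C"
    unfolding C_def using integral_norm_bound[of M "\<lambda>x. f x * g x"] by (simp add: norm_mult)
  ultimately show ?thesis
    unfolding A_def B_def by (meson norm_ge_zero order_trans power_mono)
qed

text \<open>The identity, rather than only the inequality that follows from it, serves two purposes: it
  measures the remainder of a Fourier partial sum exactly, and it evaluates the norm of a function
  that equals its own partial sum.\<close>

lemma Bessel_identity:
  assumes g: "square_integrable M g" and u: "\<And>h. h \<in> H \<Longrightarrow> square_integrable M (u h)"
    and fin: "finite H"
    and orth: "\<And>h h'. \<lbrakk>h \<in> H; h' \<in> H\<rbrakk> \<Longrightarrow> (LINT x|M. u h x * cnj (u h' x)) = (if h = h' then 1 else 0)"
  defines "c \<equiv> \<lambda>h. LINT x|M. g x * cnj (u h x)"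
  shows "(LINT x|M. (cmod (g x - (\<Sum>h\<in>H. c h * u h x)))\<^sup>2)
    = (LINT x|M. (cmod (g x))\<^sup>2) - (\<Sum>h\<in>H. (cmod (c h))\<^sup>2)"
proof -
  define P where "P x = (\<Sum>h\<in>H. c h * u h x)" for x
  have P: "square_integrable M P"
    unfolding P_def using u by (intro square_integrable_sum square_integrable_cmult)
  note mult = square_integrable_mult[OF _ square_integrable_cnj]
  have cross: "(LINT x|M. w x * cnj (P x)) = (\<Sum>h\<in>H. cnj (c h) * (LINT x|M. w x * cnj (u h x)))"
    if w: "square_integrable M w" for w
  proof -
    have "(LINT x|M. w x * cnj (P x)) = (LINT x|M. (\<Sum>h\<in>H. cnj (c h) * (w x * cnj (u h x))))"
      by (simp add: P_def sum_distrib_left mult_ac)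
    also have "\<dots> = (\<Sum>h\<in>H. LINT x|M. cnj (c h) * (w x * cnj (u h x)))"
      using mult[OF w u] by (intro Bochner_Integration.integral_sum) simp
    finally show ?thesis by simp
  qed
  have gP: "(LINT x|M. g x * cnj (P x)) = (\<Sum>h\<in>H. of_real ((cmod (c h))\<^sup>2))"
    unfolding cross[OF g] by (simp add: c_def mult.commute complex_norm_square[symmetric])
  have uP: "(LINT x|M. u h x * cnj (P x)) = cnj (c h)" if h: "h \<in> H" for h
    unfolding cross[OF u[OF h]] using h fin by (simp add: orth mult_delta_right)
  have "(LINT x|M. P x * cnj (P x)) = (LINT x|M. (\<Sum>h\<in>H. c h * (u h x * cnj (P x))))"
    unfolding P_def[of x for x] by (simp add: sum_distrib_right mult_ac)
  also have "\<dots> = (\<Sum>h\<in>H. LINT x|M. c h * (u h x * cnj (P x)))"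
    using mult[OF u P] by (intro Bochner_Integration.integral_sum) simp
  also have "\<dots> = (\<Sum>h\<in>H. of_real ((cmod (c h))\<^sup>2))"
    by (intro sum.cong) (simp_all add: uP complex_norm_square[symmetric])
  finally have PP: "(LINT x|M. P x * cnj (P x)) = (\<Sum>h\<in>H. of_real ((cmod (c h))\<^sup>2))" .
  have norm2: "(cmod z)\<^sup>2 = Re (z * cnj z)" for z
    by (metis Re_complex_of_real complex_norm_square)
  have "(LINT x|M. (cmod (g x - P x))\<^sup>2)
      = (LINT x|M. (cmod (g x))\<^sup>2 - 2 * Re (g x * cnj (P x)) + Re (P x * cnj (P x)))"
    unfolding norm2 by (intro Bochner_Integration.integral_cong) (auto simp: algebra_simps)
  also have "\<dots> = (LINT x|M. (cmod (g x))\<^sup>2) - 2 * Re (LINT x|M. g x * cnj (P x))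
      + Re (LINT x|M. P x * cnj (P x))"
    using mult[OF g P] mult[OF P P] g
    by (simp add: square_integrable_def integrable_Re integral_Re del: times_complex.sel)
  also have "\<dots> = (LINT x|M. (cmod (g x))\<^sup>2) - (\<Sum>h\<in>H. (cmod (c h))\<^sup>2)"
    unfolding gP PP by simp
  finally show ?thesis by (simp add: P_def)
qed

section \<open>Fourier coefficients on the unit interval\<close>

lemma set_lebesgue_integral_unit_interval:
  fixes f :: "real \<Rightarrow> 'a::euclidean_space"
  shows "set_lebesgue_integral lebesgue {0..1} f = integral\<^sup>L (lebesgue_on {0..1::real}) f"
  unfolding set_lebesgue_integral_def
  by (rule Bochner_Integration.integral_restrict_space[symmetric]) simp

lemma L2_01_iff_square_integrable: "g \<in> L2_01 \<longleftrightarrow> square_integrable (lebesgue_on {0..1}) g"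
  by (simp add: L2_01_def square_integrable_def set_borel_measurable_def set_integrable_def
      borel_measurable_restrict_space_iff integrable_restrict_space)

lemma continuous_imp_square_integrable:
  assumes "continuous_on {a..b} f"
  shows "square_integrable (lebesgue_on {a..b::real}) f"
  unfolding square_integrable_def
  using assms by (auto intro!: continuous_imp_measurable_on_sets_lebesgue
      continuous_imp_integrable_real continuous_intros)

text \<open>Values of integrals come from antiderivatives and hence as gauge integrals, whereas the Hilbert
  space arguments use Lebesgue integrals.\<close>

lemma lebesgue_on_integral_eqI:
  fixes f :: "real \<Rightarrow> 'a::euclidean_space"
  assumes "integrable (lebesgue_on {a..b}) f" "(f has_integral i) {a..b}"
  shows "integral\<^sup>L (lebesgue_on {a..b}) f = i"
  using has_integral_integral_lebesgue_on[OF assms(1)] assms(2) by (simp add: has_integral_unique)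

definition trig :: "int \<Rightarrow> real \<Rightarrow> complex" where
  "trig h x = exp (2 * of_real pi * \<i> * of_int h * of_real x)"

lemma trig_0 [simp]: "trig 0 x = 1" and trig_at_0 [simp]: "trig h 0 = 1"
  by (simp_all add: trig_def)

lemma trig_add: "trig (h + h') x = trig h x * trig h' x"
  by (simp add: trig_def exp_add[symmetric] algebra_simps)

lemma cnj_trig: "cnj (trig h x) = trig (-h) x"
  by (simp add: trig_def exp_cnj)

lemma norm_trig [simp]: "cmod (trig h x) = 1"
  by (simp add: trig_def)

lemma trig_at_1 [simp]: "trig h 1 = 1"
  by (simp add: trig_def exp_eq_1 exI[of _ h])

lemma trig_has_vector_derivative:
  "(trig h has_vector_derivative 2 * of_real pi * \<i> * of_int h * trig h x) (at x within S)"
  unfolding trig_def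
  by (rule has_vector_derivative_real_field) (auto intro!: derivative_eq_intros)

lemma continuous_on_trig [continuous_intros]: "continuous_on S (trig h)"
  unfolding trig_def by (intro continuous_intros)

lemma square_integrable_trig: "square_integrable (lebesgue_on {0..1}) (trig h)"
  by (intro continuous_imp_square_integrable continuous_intros)

lemma fourier_int_eq: "fourier_int h f = (LINT x|lebesgue_on {0..1}. f x * cnj (trig h x))"
  by (simp add: fourier_int_def set_lebesgue_integral_unit_interval cnj_trig) (simp add: trig_def)

lemma integral_trig: "(LINT x|lebesgue_on {0..1}. trig h x) = (if h = 0 then 1 else 0)"
proof (cases "h = 0")
  case True
  then show ?thesis by (simp add: measure_restrict_space)
next
  case False
  have "((\<lambda>x. 2 * of_real pi * \<i> * of_int h * trig h x) has_integral (trig h 1 - trig h 0)) {0..1}"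
    by (rule fundamental_theorem_of_calculus) (simp_all add: trig_has_vector_derivative)
  then have "(LINT x|lebesgue_on {0..1}. 2 * of_real pi * \<i> * of_int h * trig h x) = 0"
    by (intro lebesgue_on_integral_eqI continuous_imp_integrable_real continuous_intros) simp
  then show ?thesis using False by simp
qed

lemma trig_orthonormal:
  "(LINT x|lebesgue_on {0..1}. trig h x * cnj (trig h' x)) = (if h = h' then 1 else 0)"
  using integral_trig[of "h - h'"] trig_add[of h "-h'"] by (simp add: cnj_trig)

lemmas fourier_Bessel_identity =
  Bessel_identity[OF _ square_integrable_trig _ trig_orthonormal, folded fourier_int_eq]

lemma fourier_Bessel_inequality:
  assumes "square_integrable (lebesgue_on {0..1}) g" "finite H"
  shows "(\<Sum>h\<in>H. (cmod (fourier_int h g))\<^sup>2) \<le> (LINT x|lebesgue_on {0..1}. (cmod (g x))\<^sup>2)"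
proof -
  have "0 \<le> (LINT x|lebesgue_on {0..1}. (cmod (g x - (\<Sum>h\<in>H. fourier_int h g * trig h x)))\<^sup>2)"
    by simp
  then show ?thesis using fourier_Bessel_identity[OF assms] by simp
qed

section \<open>Fourier coefficients of derivatives\<close>

text \<open>\<open>g'\<close> is a derivative of \<open>g\<close> off the null set \<open>N\<close>. All derivatives of order less than
  \<open>s\<close> of a periodic Sobolev function, together with the next derivative, are of this kind, so one
  argument covers the everywhere differentiable ones as well as the last one.\<close>

locale periodic_AC =
  fixes g g' :: "real \<Rightarrow> complex" and N :: "real set"
  assumes AC: "abs_continuous_on {0..1} g"
    and N: "negligible N"
    and deriv: "\<And>x. x \<in> {0..1} - N \<Longrightarrow> (g has_vector_derivative g' x) (at x within {0..1})"
    and L2: "square_integrable (lebesgue_on {0..1}) g'"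
    and periodic: "g 0 = g 1"
begin

lemma integral_by_parts:
  assumes u: "\<And>x. x \<in> {0..1} \<Longrightarrow> (u has_vector_derivative u' x) (at x within {0..1})"
    and u': "continuous_on {0..1} u'"
  shows "((\<lambda>x. g' x * u x + g x * u' x) has_integral (g 1 * u 1 - g 0 * u 0)) {0..1}"
proof (rule abs_continuous_on_has_integral[OF _ _ N])
  show "abs_continuous_on {0..1} (\<lambda>x. g x * u x)"
    by (rule abs_continuous_on_mult[OF AC C1_imp_abs_continuous_on[OF u u']])
  show "((\<lambda>x. g x * u x) has_vector_derivative g' x * u x + g x * u' x) (at x within {0..1})"
    if "x \<in> {0..1} - N" for x
    using has_vector_derivative_mult[OF deriv[OF that] u[of x]] that by (simp add: add.commute)
qed simp

lemma continuous: "continuous_on {0..1} g"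
  by (rule abs_continuous_on_imp_continuous_on[OF AC])

lemma fourier_int_deriv: "fourier_int h g' = 2 * of_real pi * \<i> * of_int h * fourier_int h g"
proof -
  define w :: complex where "w = 2 * of_real pi * \<i> * of_int h"
  have "((\<lambda>x. g' x * trig (-h) x + g x * (- w * trig (-h) x)) has_integral 0) {0..1}"
    using integral_by_parts[of "trig (-h)" "\<lambda>x. - w * trig (-h) x"]
      trig_has_vector_derivative[of "-h"] periodic
    by (simp add: w_def continuous_intros)
  then have "(LINT x|lebesgue_on {0..1}. g' x * trig (-h) x + g x * (- w * trig (-h) x)) = 0"
    by (intro lebesgue_on_integral_eqI Bochner_Integration.integrable_add square_integrable_mult
        L2 continuous_imp_square_integrable continuous_intros continuous)
  moreover have "(LINT x|lebesgue_on {0..1}. g' x * trig (-h) x + g x * (- w * trig (-h) x))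
      = (LINT x|lebesgue_on {0..1}. g' x * trig (-h) x) + (LINT x|lebesgue_on {0..1}. - w * (g x * trig (-h) x))"
    by (subst Bochner_Integration.integral_add[symmetric])
      (auto intro!: Bochner_Integration.integral_cong square_integrable_mult
        L2 continuous_imp_square_integrable continuous_intros continuous)
  ultimately show ?thesis
    by (simp add: fourier_int_eq cnj_trig w_def[symmetric])
qed

end

section \<open>Pointwise convergence of Fourier series\<close>

text \<open>The first periodic Bernoulli function, shifted so that its jump is at \<open>x\<close>: on \<open>[0,1]\<close> it has
  slope 1 and mean zero, and it drops by 1 at \<open>x\<close>.\<close>

definition sawtooth :: "real \<Rightarrow> real \<Rightarrow> complex" where
  "sawtooth x y = of_real (y - x + 1/2 - (if x \<le> y then 1 else 0))"

lemma square_integrable_sawtooth: "square_integrable (lebesgue_on {0..1}) (sawtooth x)"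
proof -
  have "square_integrable (lebesgue_on {0..1}) (\<lambda>y. indicator {x..} y)"
    unfolding square_integrable_def
  proof
    show "(indicator {x..} :: real \<Rightarrow> complex) \<in> borel_measurable (lebesgue_on {0..1})"
      by (intro measurable_restrict_space1 borel_measurable_indicator) simp
    then show "integrable (lebesgue_on {0..1}) (\<lambda>y. (cmod (indicator {x..} y))\<^sup>2)"
      by (intro finite_measure.integrable_const_bound[OF finite_measure_lebesgue_on, of _ _ 1]
          borel_measurable_power borel_measurable_norm) (auto split: split_indicator)
  qed
  moreover have "square_integrable (lebesgue_on {0..1}) (\<lambda>y. of_real (y - x + 1/2))"
    by (intro continuous_imp_square_integrable continuous_intros)
  ultimately have "square_integrable (lebesgue_on {0..1}) (\<lambda>y. of_real (y - x + 1/2) - indicator {x..} y)"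
    by (rule square_integrable_diff[rotated])
  moreover have "sawtooth x = (\<lambda>y. of_real (y - x + 1/2) - indicator {x..} y)"
    by (auto simp: sawtooth_def fun_eq_iff indicator_def)
  ultimately show ?thesis by simp
qed

text \<open>At \<open>y = x\<close> the one-sided values of the sawtooth are \<open>1/2\<close> and \<open>- 1/2\<close>. Their squares agree,
  so the square is a polynomial on each of the two closed pieces.\<close>

lemma integral_sawtooth_square:
  assumes "x \<in> {0..1}"
  shows "(LINT y|lebesgue_on {0..1}. (cmod (sawtooth x y))\<^sup>2) = 1 / 12"
proof (rule lebesgue_on_integral_eqI)
  show "integrable (lebesgue_on {0..1}) (\<lambda>y. (cmod (sawtooth x y))\<^sup>2)"
    using square_integrable_sawtooth by (simp add: square_integrable_def)
  have piece: "((\<lambda>y. (y - x + c)\<^sup>2) has_integral ((b - x + c) ^ 3 / 3 - (a - x + c) ^ 3 / 3)) {a..b}"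
    if "a \<le> b" for a b c :: real
    by (rule fundamental_theorem_of_calculus[OF that])
      (auto intro!: derivative_eq_intros simp: has_real_derivative_iff_has_vector_derivative[symmetric])
  have norm: "(cmod (sawtooth x y))\<^sup>2 = (y - x + 1/2 - (if x \<le> y then 1 else 0))\<^sup>2" for y
    unfolding sawtooth_def norm_of_real by simp
  have left: "(y - x + 1/2)\<^sup>2 = (cmod (sawtooth x y))\<^sup>2" if "y \<le> x" for y
    unfolding norm by (cases "y = x") (use that in \<open>auto simp: power2_eq_square\<close>)
  have right: "(y - x - 1/2)\<^sup>2 = (cmod (sawtooth x y))\<^sup>2" if "x \<le> y" for y
    unfolding norm using that by simp
  have "((\<lambda>y. (cmod (sawtooth x y))\<^sup>2) has_integral ((x - x + 1/2) ^ 3 / 3 - (0 - x + 1/2) ^ 3 / 3)) {0..x}"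
    by (rule has_integral_eq[OF _ piece]) (use assms in \<open>auto simp: left right\<close>)
  moreover have "((\<lambda>y. (cmod (sawtooth x y))\<^sup>2) has_integral ((1 - x + - 1/2) ^ 3 / 3 - (x - x + -1/2) ^ 3 / 3)) {x..1}"
    by (rule has_integral_eq[OF _ piece]) (use assms in \<open>auto simp: left right\<close>)
  ultimately have "((\<lambda>y. (cmod (sawtooth x y))\<^sup>2) has_integral
     ((x - x + 1/2) ^ 3 / 3 - (0 - x + 1/2) ^ 3 / 3) + ((1 - x + - 1/2) ^ 3 / 3 - (x - x + -1/2) ^ 3 / 3)) {0..1}"
    using assms by (intro has_integral_combine[of 0 x 1]) auto
  moreover have "((x - x + 1/2) ^ 3 / 3 - (0 - x + 1/2) ^ 3 / 3) + ((1 - x + - 1/2) ^ 3 / 3 - (x - x + -1/2) ^ 3 / 3) = 1/12"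
    by (simp add: power3_eq_cube field_simps)
  ultimately show "((\<lambda>y. (cmod (sawtooth x y))\<^sup>2) has_integral 1 / 12) {0..1}" by (simp only:)
qed

text \<open>Integrating \<open>g'\<close> by parts against the linear part of the sawtooth produces the mean of \<open>g\<close> and
  boundary terms; integrating \<open>g'\<close> over \<open>[x,1]\<close>, where the sawtooth is lower by 1, turns the
  boundary terms into \<open>g x\<close>.\<close>

lemma (in periodic_AC) sawtooth_representation:
  assumes x: "x \<in> {0..1}"
  shows "g x = fourier_int 0 g + (LINT y|lebesgue_on {0..1}. g' y * sawtooth x y)"
proof -
  define u :: "real \<Rightarrow> complex" where "u y = of_real (y - x + 1/2)" for y
  have "((\<lambda>y. g' y * u y + g y * 1) has_integral (g 1 * u 1 - g 0 * u 0)) {0..1}"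
    by (rule integral_by_parts)
      (auto simp: u_def intro!: derivative_eq_intros has_vector_derivative_of_real)
  moreover have "(g' has_integral (g 1 - g x)) {x..1}"
  proof (rule abs_continuous_on_has_integral[OF _ _ N])
    show "abs_continuous_on {x..1} g"
      using abs_continuous_on_subset[OF AC] x by simp
    show "(g has_vector_derivative g' y) (at y within {x..1})" if "y \<in> {x..1} - N" for y
      using has_vector_derivative_within_subset[OF deriv[of y]] that x by auto
  qed (use x in simp)
  then have "((\<lambda>y. if y \<in> {x..1} then g' y else 0) has_integral (g 1 - g x)) {0..1}"
    using x by (subst has_integral_restrict) auto
  ultimately have "((\<lambda>y. (g' y * u y + g y * 1) - (if y \<in> {x..1} then g' y else 0)) has_integral
     (g 1 * u 1 - g 0 * u 0) - (g 1 - g x)) {0..1}"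
    by (rule has_integral_diff)
  moreover have "(g 1 * u 1 - g 0 * u 0) - (g 1 - g x) = g x"
    by (simp add: u_def periodic algebra_simps)
  ultimately have "((\<lambda>y. g' y * sawtooth x y + g y) has_integral g x) {0..1}"
    by (subst has_integral_cong[where g="\<lambda>y. (g' y * u y + g y * 1) - (if y \<in> {x..1} then g' y else 0)"])
      (auto simp: u_def sawtooth_def algebra_simps)
  moreover have int: "integrable (lebesgue_on {0..1}) (\<lambda>y. g' y * sawtooth x y)"
    "integrable (lebesgue_on {0..1}) g"
    using continuous by (intro square_integrable_mult L2 square_integrable_sawtooth continuous_imp_integrable_real; simp)+
  ultimately have "(LINT y|lebesgue_on {0..1}. g' y * sawtooth x y + g y) = g x"
    by (intro lebesgue_on_integral_eqI) auto
  with int have "(LINT y|lebesgue_on {0..1}. g' y * sawtooth x y) + (LINT y|lebesgue_on {0..1}. g y) = g x"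
    by simp
  then show ?thesis by (simp add: fourier_int_eq) (metis add.commute)
qed

lemma periodic_AC_trig:
  "periodic_AC (trig h) (\<lambda>x. 2 * of_real pi * \<i> * of_int h * trig h x) {}"
proof
  show "abs_continuous_on {0..1} (trig h)"
    by (rule C1_imp_abs_continuous_on) (auto intro!: trig_has_vector_derivative continuous_intros)
qed (auto intro!: trig_has_vector_derivative continuous_imp_square_integrable continuous_intros)

text \<open>The representation formula, applied to the exponential of frequency \<open>- h\<close> itself, is an
  equation for the coefficient.\<close>

lemma fourier_int_sawtooth:
  assumes "x \<in> {0..1}" "h \<noteq> 0"
  shows "fourier_int h (sawtooth x) = - trig (-h) x / (2 * of_real pi * \<i> * of_int h)"
proof -
  interpret periodic_AC "trig (-h)" "\<lambda>x. 2 * of_real pi * \<i> * of_int (-h) * trig (-h) x" "{}"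
    by (rule periodic_AC_trig)
  have "fourier_int 0 (trig (-h)) = 0"
    using assms by (simp add: fourier_int_eq integral_trig)
  then have "trig (-h) x = (LINT y|lebesgue_on {0..1}. - (2 * of_real pi * \<i> * of_int h) * (sawtooth x y * trig (-h) y))"
    using sawtooth_representation[OF assms(1)] by (simp add: mult_ac)
  then have "trig (-h) x = - (2 * of_real pi * \<i> * of_int h) * fourier_int h (sawtooth x)"
    by (simp add: fourier_int_eq cnj_trig)
  then show ?thesis using assms by (simp add: field_simps)
qed

lemma sum_symmetric_interval:
  fixes f :: "int \<Rightarrow> 'a::comm_monoid_add"
  shows "(\<Sum>h\<in>{- int n..int n} - {0}. f h) = (\<Sum>i<n. f (1 + int i) + f (- 1 - int i))"
proof (induction n)
  case (Suc n)
  have "{- int (Suc n)..int (Suc n)} - {0}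
      = insert (1 + int n) (insert (- 1 - int n) ({- int n..int n} - {0}))"
    by auto
  then show ?case by (simp add: Suc add_ac)
qed simp

text \<open>The error of the partial sum is the inner product of \<open>g'\<close> with the error \<open>K - P n\<close> of the partial
  sum of the sawtooth \<open>K\<close>. By the Bessel identity the squared norm \<open>R n\<close> of the latter is \<open>1/12\<close>
  minus a partial sum of \<open>1 / (2 \<pi>^2) * (\<Sum>j. 1 / j^2)\<close>, which tends to 0.\<close>

lemma (in periodic_AC) fourier_series_tendsto:
  assumes x: "x \<in> {0..1}"
  shows "(\<lambda>n. \<Sum>h\<in>{- int n..int n}. fourier_int h g * trig h x) \<longlonglongrightarrow> g x"
proof -
  let ?M = "lebesgue_on {0..1::real}"
  define K where "K = sawtooth x"
  define H where "H n = {- int n..int n} - {0}" for n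
  define P where "P n y = (\<Sum>h\<in>H n. fourier_int h K * trig h y)" for n y
  define G where "G = (LINT y|?M. (cmod (g' y))\<^sup>2)"
  define R where "R n = 1/12 - (\<Sum>i<n. 1 / (real i + 1)\<^sup>2) / (2 * pi\<^sup>2)" for n
  have K: "square_integrable ?M K" by (simp add: K_def square_integrable_sawtooth)
  have P: "square_integrable ?M (P n)" for n
    unfolding P_def by (intro square_integrable_sum square_integrable_cmult square_integrable_trig)
  have coeff: "fourier_int h K = - trig (-h) x / (2 * of_real pi * \<i> * of_int h)" if "h \<in> H n" for h n
    unfolding K_def using that x by (intro fourier_int_sawtooth) (auto simp: H_def)
  have error: "g x - (\<Sum>h\<in>{- int n..int n}. fourier_int h g * trig h x)
      = (LINT y|?M. g' y * cnj (K y - P n y))" for n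
  proof -
    have "(LINT y|?M. g' y * cnj (P n y))
        = (LINT y|?M. (\<Sum>h\<in>H n. cnj (fourier_int h K) * (g' y * cnj (trig h y))))"
      by (simp add: P_def sum_distrib_left mult_ac)
    also have "\<dots> = (\<Sum>h\<in>H n. LINT y|?M. cnj (fourier_int h K) * (g' y * cnj (trig h y)))"
      using square_integrable_mult[OF L2 square_integrable_cnj[OF square_integrable_trig]]
      by (intro Bochner_Integration.integral_sum) simp
    also have "\<dots> = (\<Sum>h\<in>H n. cnj (fourier_int h K) * fourier_int h g')"
      by (simp add: fourier_int_eq)
    also have "\<dots> = (\<Sum>h\<in>H n. fourier_int h g * trig h x)"
      by (intro sum.cong) (auto simp: coeff fourier_int_deriv cnj_trig H_def)
    finally have "(LINT y|?M. g' y * cnj (P n y)) = (\<Sum>h\<in>H n. fourier_int h g * trig h x)" .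
    moreover have "(LINT y|?M. g' y * cnj (K y)) = g x - fourier_int 0 g"
      using sawtooth_representation[OF x] by (simp add: K_def sawtooth_def)
    moreover have "(LINT y|?M. g' y * cnj (K y - P n y))
        = (LINT y|?M. g' y * cnj (K y)) - (LINT y|?M. g' y * cnj (P n y))"
      using square_integrable_mult[OF L2 square_integrable_cnj[OF K]]
        square_integrable_mult[OF L2 square_integrable_cnj[OF P]]
      by (simp add: right_diff_distrib)
    moreover have "(\<Sum>h\<in>{- int n..int n}. fourier_int h g * trig h x)
        = fourier_int 0 g + (\<Sum>h\<in>H n. fourier_int h g * trig h x)"
      unfolding H_def by (subst sum.remove[of _ 0]) auto
    ultimately show ?thesis by simp
  qed
  have KP: "(LINT y|?M. (cmod (K y - P n y))\<^sup>2) = R n" for n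
  proof -
    have "(LINT y|?M. (cmod (K y - P n y))\<^sup>2) = 1/12 - (\<Sum>h\<in>H n. (cmod (fourier_int h K))\<^sup>2)"
      unfolding P_def using fourier_Bessel_identity[OF K, of "H n"] integral_sawtooth_square[OF x]
      by (simp add: H_def K_def)
    also have "(\<Sum>h\<in>H n. (cmod (fourier_int h K))\<^sup>2) = (\<Sum>h\<in>H n. 1 / (2 * pi * of_int h)\<^sup>2)"
      by (intro sum.cong) (simp_all add: coeff norm_divide norm_mult power_divide power_mult_distrib)
    also have "\<dots> = (\<Sum>i<n. (1 / (real i + 1)\<^sup>2) * (1 / (2 * pi\<^sup>2)))"
      unfolding H_def sum_symmetric_interval
    proof (intro sum.cong refl)
      fix i
      have "(2 * pi * of_int (1 + int i))\<^sup>2 = 4 * pi\<^sup>2 * (real i + 1)\<^sup>2"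
        "(2 * pi * of_int (- 1 - int i))\<^sup>2 = 4 * pi\<^sup>2 * (real i + 1)\<^sup>2"
        by (simp_all add: power2_eq_square algebra_simps)
      then show "1 / (2 * pi * of_int (1 + int i))\<^sup>2 + 1 / (2 * pi * of_int (- 1 - int i))\<^sup>2
          = (1 / (real i + 1)\<^sup>2) * (1 / (2 * pi\<^sup>2))"
        by simp
    qed
    finally show ?thesis by (simp add: R_def sum_divide_distrib)
  qed
  have "(\<lambda>n. \<Sum>i<n. 1 / (real i + 1)\<^sup>2) \<longlonglongrightarrow> pi\<^sup>2 / 6"
    using inverse_squares_sums by (simp add: sums_def add.commute)
  then have "R \<longlonglongrightarrow> 1/12 - pi\<^sup>2 / 6 / (2 * pi\<^sup>2)"
    unfolding R_def by (intro tendsto_intros) auto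
  then have "R \<longlonglongrightarrow> 0" by simp
  then have "(\<lambda>n. sqrt (G * R n)) \<longlonglongrightarrow> sqrt (G * 0)"
    by (intro tendsto_intros)
  then have lim: "(\<lambda>n. sqrt (G * R n)) \<longlonglongrightarrow> 0" by simp
  have "cmod ((\<Sum>h\<in>{- int n..int n}. fourier_int h g * trig h x) - g x) \<le> sqrt (G * R n)" for n
  proof -
    have "(cmod (g x - (\<Sum>h\<in>{- int n..int n}. fourier_int h g * trig h x)))\<^sup>2 \<le> G * R n"
      using complex_integral_Cauchy_Schwarz[OF L2 square_integrable_cnj[OF square_integrable_diff[OF K P]], of n]
      by (simp add: error[symmetric] G_def KP[symmetric] del: complex_cnj_diff)
    then show ?thesis by (simp add: norm_minus_commute real_le_rsqrt)
  qed
  then have "(\<lambda>n. (\<Sum>h\<in>{- int n..int n}. fourier_int h g * trig h x) - g x) \<longlonglongrightarrow> 0"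
    by (intro Lim_null_comparison[OF _ lim] always_eventually) simp
  then show ?thesis by (simp add: LIM_zero_iff)
qed

section \<open>The periodic Sobolev norm in terms of Fourier coefficients\<close>

lemma deriv01_0 [simp]: "deriv01 0 f = f"
  by (simp add: deriv01_def)

lemma deriv01_Suc: "deriv01 (Suc l) f x = vector_derivative (deriv01 l f) (at x within {0..1})"
  by (simp add: deriv01_def)

lemma deriv01_has_vector_derivative:
  "deriv01 l f differentiable (at x within {0..1}) \<Longrightarrow>
    (deriv01 l f has_vector_derivative deriv01 (Suc l) f x) (at x within {0..1})"
  by (simp add: deriv01_Suc vector_derivative_works)

text \<open>Below order \<open>s - 1\<close> the next derivative exists everywhere and is continuous, so the function is
  continuously differentiable; at order \<open>s - 1\<close> the properties are those that define the space.\<close>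

lemma periodic_sobolev_periodic_AC:
  assumes f: "f \<in> periodic_sobolev s" and l: "l < s"
  shows "\<exists>N. periodic_AC (deriv01 l f) (deriv01 (Suc l) f) N"
proof -
  have diff: "\<And>l x. \<lbrakk>l < s - 1; x \<in> {0..1}\<rbrakk> \<Longrightarrow> deriv01 l f differentiable (at x within {0..1})"
    and AC: "abs_continuous_on {0..1} (deriv01 (s - 1) f)"
    and AE: "AE x in lebesgue. x \<in> {0..1} \<longrightarrow> deriv01 (s - 1) f differentiable (at x within {0..1})"
    and L2: "deriv01 s f \<in> L2_01"
    and periodic: "\<And>l. l < s \<Longrightarrow> deriv01 l f 0 = deriv01 l f 1"
    using f unfolding periodic_sobolev_def sobolev_def by blast+
  show ?thesis
  proof (cases "l = s - 1")
    case True
    then have Suc: "Suc l = s" using l by simp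
    obtain N where N: "N \<in> null_sets lebesgue"
      "{x \<in> space lebesgue. \<not> (x \<in> {0..1} \<longrightarrow> deriv01 (s - 1) f differentiable (at x within {0..1}))} \<subseteq> N"
      using AE unfolding eventually_ae_filter by blast
    have "periodic_AC (deriv01 l f) (deriv01 (Suc l) f) N"
    proof
      show "abs_continuous_on {0..1} (deriv01 l f)" using AC True by simp
      show "negligible N" using N by (simp add: negligible_iff_null_sets)
      show "(deriv01 l f has_vector_derivative deriv01 (Suc l) f x) (at x within {0..1})"
        if "x \<in> {0..1} - N" for x
        using N(2) that True by (intro deriv01_has_vector_derivative) auto
      show "square_integrable (lebesgue_on {0..1}) (deriv01 (Suc l) f)"
        using L2 Suc by (simp add: L2_01_iff_square_integrable)
    qed (use periodic l in simp)
    then show ?thesis ..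
  next
    case False
    then have l': "l < s - 1" using l by simp
    have cont: "continuous_on {0..1} (deriv01 (Suc l) f)"
    proof (cases "Suc l = s - 1")
      case True
      then show ?thesis using abs_continuous_on_imp_continuous_on[OF AC] by simp
    next
      case False
      then have "Suc l < s - 1" using l' by simp
      then show ?thesis
        using diff differentiable_imp_continuous_within continuous_on_eq_continuous_within by blast
    qed
    have deriv: "(deriv01 l f has_vector_derivative deriv01 (Suc l) f x) (at x within {0..1})"
      if "x \<in> {0..1}" for x
      using diff[OF l' that] by (rule deriv01_has_vector_derivative)
    have "periodic_AC (deriv01 l f) (deriv01 (Suc l) f) {}"
    proof
      show "abs_continuous_on {0..1} (deriv01 l f)"
        by (rule C1_imp_abs_continuous_on[OF deriv cont])
      show "square_integrable (lebesgue_on {0..1}) (deriv01 (Suc l) f)"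
        by (rule continuous_imp_square_integrable[OF cont])
    qed (use periodic l deriv in auto)
    then show ?thesis ..
  qed
qed

lemma fourier_int_deriv01:
  assumes f: "f \<in> periodic_sobolev s" and "l \<le> s"
  shows "fourier_int h (deriv01 l f) = (2 * of_real pi * \<i> * of_int h) ^ l * fourier_int h f"
  using \<open>l \<le> s\<close>
proof (induction l)
  case (Suc l)
  then obtain N where "periodic_AC (deriv01 l f) (deriv01 (Suc l) f) N"
    using periodic_sobolev_periodic_AC[OF f, of l] by auto
  then show ?case using Suc by (simp add: periodic_AC.fourier_int_deriv)
qed simp

lemma square_integrable_deriv01:
  assumes f: "f \<in> periodic_sobolev s"
  shows "square_integrable (lebesgue_on {0..1}) (deriv01 s f)"
  using f by (simp add: periodic_sobolev_def sobolev_def L2_01_iff_square_integrable)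

text \<open>Of the mean value terms in the inner product only the one of order 0 survives, as derivatives of
  periodic functions have mean zero.\<close>

lemma Re_sob_inner_self:
  assumes f: "f \<in> periodic_sobolev s" and s: "1 \<le> s"
  shows "Re (sob_inner s f f) = (cmod (fourier_int 0 f))\<^sup>2 + (LINT x|lebesgue_on {0..1}. (cmod (deriv01 s f x))\<^sup>2)"
proof -
  have "(LINT x:{0..1}|lebesgue. deriv01 l f x) * (LINT x:{0..1}|lebesgue. cnj (deriv01 l f x))
      = of_real ((cmod (fourier_int 0 (deriv01 l f)))\<^sup>2)" for l
    unfolding complex_norm_square by (simp add: set_lebesgue_integral_unit_interval fourier_int_eq)
  moreover have "(LINT x:{0..1}|lebesgue. deriv01 s f x * cnj (deriv01 s f x))
      = of_real (LINT x|lebesgue_on {0..1}. (cmod (deriv01 s f x))\<^sup>2)"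
    unfolding complex_norm_square[symmetric] set_lebesgue_integral_unit_interval
    by (rule integral_complex_of_real)
  ultimately have "Re (sob_inner s f f) = (\<Sum>l<s. (cmod (fourier_int 0 (deriv01 l f)))\<^sup>2)
      + (LINT x|lebesgue_on {0..1}. (cmod (deriv01 s f x))\<^sup>2)"
    unfolding sob_inner_def by (simp del: of_real_power)
  also have "(\<Sum>l<s. (cmod (fourier_int 0 (deriv01 l f)))\<^sup>2)
      = (\<Sum>l<s. if l = 0 then (cmod (fourier_int 0 f))\<^sup>2 else 0)"
    by (intro sum.cong refl) (simp add: fourier_int_deriv01[OF f])
  also have "\<dots> = (cmod (fourier_int 0 f))\<^sup>2" using s by simp
  finally show ?thesis .
qed

lemma sob_norm_square:
  assumes "f \<in> periodic_sobolev s" "1 \<le> s"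
  shows "(sob_norm s f)\<^sup>2 = (cmod (fourier_int 0 f))\<^sup>2 + (LINT x|lebesgue_on {0..1}. (cmod (deriv01 s f x))\<^sup>2)"
  using Re_sob_inner_self[OF assms] by (simp add: sob_norm_def)

text \<open>The squared Sobolev norm of the exponential of frequency \<open>h\<close>.\<close>

definition sobolev_weight :: "nat \<Rightarrow> int \<Rightarrow> real" where
  "sobolev_weight s h = max 1 ((2 * pi * real_of_int h) ^ (2 * s))"

lemma sobolev_weight_ge_1: "1 \<le> sobolev_weight s h"
  by (simp add: sobolev_weight_def)

lemma sobolev_weight_pos: "0 < sobolev_weight s h"
  using sobolev_weight_ge_1[of s h] by linarith

lemma one_le_two_pi_power:
  assumes "1 \<le> \<bar>x\<bar>"
  shows "1 \<le> (2 * pi * x) ^ (2 * s)"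
proof -
  have "1 * 1 \<le> (2 * pi) * \<bar>x\<bar>" using pi_gt3 assms by (intro mult_mono) auto
  then have "1 \<le> \<bar>2 * pi * x\<bar>" by (simp add: abs_mult)
  then have "1 \<le> \<bar>2 * pi * x\<bar> ^ (2 * s)" by (rule one_le_power)
  then show ?thesis by (simp add: power_even_abs)
qed

text \<open>The two summands are the contributions of the mean and of the derivative of order \<open>s\<close>. They agree
  with the maximum because \<open>2 \<pi> |h| \<ge> 1\<close> for every nonzero integer \<open>h\<close>.\<close>

lemma sobolev_weight_eq:
  assumes "1 \<le> s"
  shows "sobolev_weight s h = (if h = 0 then 1 else 0) + (2 * pi * real_of_int h) ^ (2 * s)"
proof (cases "h = 0")
  case True
  then show ?thesis using assms by (simp add: sobolev_weight_def power_0_left)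
next
  case False
  then have "1 \<le> \<bar>real_of_int h\<bar>" by linarith
  then show ?thesis using False one_le_two_pi_power[of "real_of_int h" s]
    by (simp add: sobolev_weight_def)
qed

lemma norm_two_pi_power: "(cmod ((2 * of_real pi * \<i> * of_int h) ^ s))\<^sup>2 = (2 * pi * real_of_int h) ^ (2 * s)"
proof -
  have "(cmod ((2 * of_real pi * \<i> * of_int h) ^ s))\<^sup>2 = \<bar>2 * pi * real_of_int h\<bar> ^ (2 * s)"
    by (simp add: norm_power norm_mult abs_mult power_mult[symmetric] mult.commute)
  then show ?thesis by (simp add: power_even_abs)
qed

lemma sum_sobolev_weight_le:
  assumes f: "f \<in> periodic_sobolev s" and s: "1 \<le> s" and H: "finite H"
  shows "(\<Sum>h\<in>H. sobolev_weight s h * (cmod (fourier_int h f))\<^sup>2) \<le> (sob_norm s f)\<^sup>2"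
proof -
  have deriv: "(cmod (fourier_int h (deriv01 s f)))\<^sup>2
      = (2 * pi * real_of_int h) ^ (2 * s) * (cmod (fourier_int h f))\<^sup>2" for h
    by (simp only: fourier_int_deriv01[OF f order_refl] norm_mult[of "_ ^ s"]
        power_mult_distrib[of "cmod _"] norm_two_pi_power)
  have "(\<Sum>h\<in>H. sobolev_weight s h * (cmod (fourier_int h f))\<^sup>2)
      = (\<Sum>h\<in>H. if h = 0 then (cmod (fourier_int 0 f))\<^sup>2 else 0)
        + (\<Sum>h\<in>H. (cmod (fourier_int h (deriv01 s f)))\<^sup>2)"
    unfolding sum.distrib[symmetric] sobolev_weight_eq[OF s]
    by (intro sum.cong refl) (simp add: deriv distrib_right)
  also have "(\<Sum>h\<in>H. if h = 0 then (cmod (fourier_int 0 f))\<^sup>2 else 0) \<le> (cmod (fourier_int 0 f))\<^sup>2"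
    using H by simp
  also note fourier_Bessel_inequality[OF square_integrable_deriv01[OF f] H]
  finally show ?thesis unfolding sob_norm_square[OF f s] by simp
qed

section \<open>Aliasing\<close>

text \<open>A sum of all powers of an \<open>n\<close>-th root of unity.\<close>

lemma sum_trig_equidistant:
  assumes n: "1 \<le> n"
  shows "1 / of_nat n * (\<Sum>j=1..n. trig m (real j / real n)) = (if int n dvd m then 1 else 0)"
proof -
  define w where "w = trig m (1 / real n)"
  have pow: "trig m (real j / real n) = w ^ j" for j
    by (simp add: w_def trig_def exp_of_nat_mult[symmetric] mult_ac)
  show ?thesis
  proof (cases "int n dvd m")
    case True
    then obtain q where "m = int n * q" ..
    then have "w = trig q 1" using n by (simp add: w_def trig_def mult.assoc)
    then show ?thesis using n True by (simp add: pow)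
  next
    case False
    have "w \<noteq> 1"
    proof
      assume "w = 1"
      then obtain q :: int where
        "Im (2 * of_real pi * \<i> * of_int m * of_real (1 / real n)) = of_int (2 * q) * pi"
        unfolding w_def trig_def exp_eq_1 by blast
      then have "real_of_int m = real_of_int q * real n" using n by (simp add: field_simps)
      then have "m = q * int n" by (metis of_int_eq_iff of_int_mult of_int_of_nat_eq)
      then show False using False by simp
    qed
    moreover have "w ^ n = 1"
      using pow[of n] n by simp
    moreover have "(\<Sum>j=1..n. w ^ j) = w * (\<Sum>j<n. w ^ j)"
      by (simp add: sum_distrib_left sum.atLeast1_atMost_eq)
    ultimately show ?thesis using False by (simp add: pow geometric_sum)
  qed
qed

lemma qmc_eq: "qmc n k f = 1 / of_nat n * (\<Sum>j=1..n. f (real j / real n) * cnj (trig k (real j / real n)))"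
  by (simp add: qmc_def cnj_trig) (simp add: trig_def)

lemma qmc_trig_sum:
  assumes n: "1 \<le> n" and fin: "finite H"
    and f: "\<And>x. x \<in> {0..1} \<Longrightarrow> f x = (\<Sum>h\<in>H. c h * trig h x)"
  shows "qmc n k f = (\<Sum>h \<in> {h \<in> H. int n dvd h - k}. c h)"
proof -
  have "qmc n k f = 1 / of_nat n * (\<Sum>j=1..n. \<Sum>h\<in>H. c h * trig (h - k) (real j / real n))"
    unfolding qmc_eq
  proof (intro arg_cong[of _ _ "(*) _"] sum.cong refl)
    fix j assume "j \<in> {1..n}"
    then have "f (real j / real n) = (\<Sum>h\<in>H. c h * trig h (real j / real n))"
      by (intro f) simp
    then show "f (real j / real n) * cnj (trig k (real j / real n))
        = (\<Sum>h\<in>H. c h * trig (h - k) (real j / real n))"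
      using trig_add[of _ "-k"] by (simp add: sum_distrib_right cnj_trig mult.assoc)
  qed
  also have "\<dots> = (\<Sum>h\<in>H. c h * (1 / of_nat n * (\<Sum>j=1..n. trig (h - k) (real j / real n))))"
    by (subst sum.swap) (simp add: sum_distrib_left mult_ac)
  also have "\<dots> = (\<Sum>h \<in> {h \<in> H. int n dvd h - k}. c h)"
    unfolding sum_trig_equidistant[OF n] using fin by (simp add: mult_delta_right sum.If_cases Int_def)
  finally show ?thesis .
qed

text \<open>The frequencies other than \<open>k\<close> that the nodes \<open>j / n\<close> cannot distinguish from \<open>k\<close>, up to
  \<open>m\<close> periods away. Finite symmetric blocks suffice, since both bounds are obtained as limits of
  finite sums.\<close>

definition aliases :: "nat \<Rightarrow> int \<Rightarrow> nat \<Rightarrow> int set" where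
  "aliases n k m = (\<lambda>j. k + j * int n) ` ({- int m..int m} - {0})"

lemma finite_aliases [simp]: "finite (aliases n k m)"
  by (simp add: aliases_def)

lemma aliases_dvd: "h \<in> aliases n k m \<Longrightarrow> int n dvd h - k"
  by (auto simp: aliases_def)

lemma not_in_aliases: "1 \<le> n \<Longrightarrow> k \<notin> aliases n k m"
  by (auto simp: aliases_def)

lemma sum_aliases:
  fixes F :: "int \<Rightarrow> 'a::comm_monoid_add"
  assumes "1 \<le> n"
  shows "(\<Sum>h\<in>aliases n k m. F h) = (\<Sum>j<m. F (k + (1 + int j) * int n) + F (k - (1 + int j) * int n))"
proof -
  have "(\<Sum>h\<in>aliases n k m. F h) = (\<Sum>j\<in>{- int m..int m} - {0}. F (k + j * int n))"
    unfolding aliases_def using assms by (subst sum.reindex) (auto simp: inj_on_def)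
  also have "\<dots> = (\<Sum>j<m. F (k + (1 + int j) * int n) + F (k - (1 + int j) * int n))"
    unfolding sum_symmetric_interval by (intro sum.cong) (simp_all add: algebra_simps)
  finally show ?thesis .
qed

lemma alias_in_aliases:
  assumes n: "1 \<le> n" and "int n dvd h - k" "h \<noteq> k" "\<bar>h - k\<bar> \<le> int m"
  shows "h \<in> aliases n k m"
proof -
  obtain j where j: "h - k = int n * j" using assms(2) ..
  have "\<bar>j\<bar> * 1 \<le> \<bar>j\<bar> * int n" using n by (intro mult_left_mono) auto
  then have "\<bar>j\<bar> \<le> \<bar>h - k\<bar>" by (simp add: j abs_mult mult.commute)
  moreover have "j \<noteq> 0" using j assms by auto
  ultimately have "j \<in> {- int m..int m} - {0}" using assms by auto
  then show ?thesis unfolding aliases_def using j by (intro image_eqI[of _ _ j]) (auto simp: mult.commute)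
qed

section \<open>Upper bounds for the errors\<close>

text \<open>Cauchy-Schwarz with the summands split as \<open>1 / sqrt (r h)\<close> times \<open>sqrt (r h) * |c h|\<close>.\<close>

lemma norm_sum_fourier_int_le:
  assumes f: "f \<in> periodic_ball s" and s: "1 \<le> s" and H: "finite H"
  shows "(cmod (\<Sum>h\<in>H. fourier_int h f))\<^sup>2 \<le> (\<Sum>h\<in>H. 1 / sobolev_weight s h)"
proof -
  let ?r = "sobolev_weight s"
  have ps: "f \<in> periodic_sobolev s" and norm: "sob_norm s f \<le> 1"
    using f by (auto simp: periodic_ball_def)
  have "0 \<le> sob_norm s f"
    using Re_sob_inner_self[OF ps s] by (simp add: sob_norm_def)
  then have "(sob_norm s f)\<^sup>2 \<le> 1" using norm by (simp add: power_le_one)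
  then have le1: "(\<Sum>h\<in>H. ?r h * (cmod (fourier_int h f))\<^sup>2) \<le> 1"
    using sum_sobolev_weight_le[OF ps s H] by linarith
  have "(cmod (\<Sum>h\<in>H. fourier_int h f))\<^sup>2 \<le> (\<Sum>h\<in>H. cmod (fourier_int h f))\<^sup>2"
    by (intro power_mono norm_sum) simp
  also have "\<dots> = (\<Sum>h\<in>H. (1 / sqrt (?r h)) * (sqrt (?r h) * cmod (fourier_int h f)))\<^sup>2"
    using sobolev_weight_pos[of s] by (simp add: less_imp_neq[symmetric])
  also have "\<dots> \<le> (\<Sum>h\<in>H. (1 / sqrt (?r h))\<^sup>2) * (\<Sum>h\<in>H. (sqrt (?r h) * cmod (fourier_int h f))\<^sup>2)"
    by (rule Cauchy_Schwarz_ineq_sum)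
  also have "\<dots> = (\<Sum>h\<in>H. 1 / ?r h) * (\<Sum>h\<in>H. ?r h * (cmod (fourier_int h f))\<^sup>2)"
    using sobolev_weight_pos[of s] by (simp add: power_divide power_mult_distrib less_imp_le)
  also have "\<dots> \<le> (\<Sum>h\<in>H. 1 / ?r h) * 1"
    using le1 sobolev_weight_pos[of s] by (intro mult_left_mono sum_nonneg) (auto simp: less_imp_le)
  finally show ?thesis by simp
qed

lemma init_error_le:
  assumes s: "1 \<le> s"
  shows "init_error s k \<le> ereal (sqrt (1 / sobolev_weight s k))"
  unfolding init_error_def
proof (rule SUP_least)
  fix f assume "f \<in> periodic_ball s"
  from norm_sum_fourier_int_le[OF this s, of "{k}"]
  show "ereal (cmod (fourier_int k f)) \<le> ereal (sqrt (1 / sobolev_weight s k))"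
    by (simp add: real_le_rsqrt)
qed

text \<open>The quadrature formula is a finite combination of point values, so it passes to the limit
  along the Fourier partial sums \<open>S N\<close>. On \<open>S N\<close> it returns the coefficient of \<open>k\<close> plus the sum
  \<open>E N\<close> over those aliases of \<open>k\<close> that occur in \<open>S N\<close>.\<close>

lemma qmc_error_le:
  assumes f: "f \<in> periodic_ball s" and s: "1 \<le> s" and n: "1 \<le> n"
    and W: "\<And>m. (\<Sum>h\<in>aliases n k m. 1 / sobolev_weight s h) \<le> W"
  shows "cmod (fourier_int k f - qmc n k f) \<le> sqrt W"
proof -
  have ps: "f \<in> periodic_sobolev s" using f by (simp add: periodic_ball_def)
  obtain Z where "periodic_AC (deriv01 0 f) (deriv01 (Suc 0) f) Z"
    using periodic_sobolev_periodic_AC[OF ps, of 0] s by auto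
  then interpret periodic_AC f "deriv01 (Suc 0) f" Z by simp
  define S where "S N x = (\<Sum>h\<in>{- int N..int N}. fourier_int h f * trig h x)" for N x
  define E where "E N = (\<Sum>h \<in> {h \<in> {- int N..int N}. int n dvd h - k} - {k}. fourier_int h f)" for N
  have "(\<lambda>N. S N x) \<longlonglongrightarrow> f x" if "x \<in> {0..1}" for x
    unfolding S_def using that by (rule fourier_series_tendsto)
  then have "(\<lambda>N. qmc n k (S N)) \<longlonglongrightarrow> qmc n k f"
    unfolding qmc_eq by (intro tendsto_intros) auto
  moreover have "\<forall>\<^sub>F N in sequentially. qmc n k (S N) = fourier_int k f + E N"
  proof (rule eventually_sequentiallyI[of "nat \<bar>k\<bar>"])
    fix N assume N: "nat \<bar>k\<bar> \<le> N"
    have "qmc n k (S N) = (\<Sum>h \<in> {h \<in> {- int N..int N}. int n dvd h - k}. fourier_int h f)"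
      by (rule qmc_trig_sum[OF n]) (simp_all add: S_def)
    also have "\<dots> = fourier_int k f + E N"
      unfolding E_def using N
      by (intro sum.remove) (auto intro: finite_subset[of _ "{- int N..int N}"])
    finally show "qmc n k (S N) = fourier_int k f + E N" .
  qed
  ultimately have "(\<lambda>N. fourier_int k f + E N) \<longlonglongrightarrow> qmc n k f"
    by (rule Lim_transform_eventually)
  then have "(\<lambda>N. cmod (fourier_int k f - (fourier_int k f + E N))) \<longlonglongrightarrow> cmod (fourier_int k f - qmc n k f)"
    by (intro tendsto_intros)
  then have "(\<lambda>N. cmod (E N)) \<longlonglongrightarrow> cmod (fourier_int k f - qmc n k f)" by simp
  moreover have "cmod (E N) \<le> sqrt W" for N
  proof -
    define H where "H = {h \<in> {- int N..int N}. int n dvd h - k} - {k}"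
    \<comment> \<open>The aliases occurring in \<open>S N\<close> are symmetric about 0, the block is symmetric about \<open>k\<close>.\<close>
    have sub: "H \<subseteq> aliases n k (N + nat \<bar>k\<bar>)"
      unfolding H_def by (auto intro!: alias_in_aliases[OF n])
    then have "(\<Sum>h\<in>H. 1 / sobolev_weight s h) \<le> (\<Sum>h\<in>aliases n k (N + nat \<bar>k\<bar>). 1 / sobolev_weight s h)"
      using sobolev_weight_pos[of s] by (intro sum_mono2) (auto simp: less_imp_le)
    also note W
    finally have "(cmod (E N))\<^sup>2 \<le> W"
      using norm_sum_fourier_int_le[OF f s finite_subset[OF sub finite_aliases]]
      unfolding E_def H_def[symmetric] by linarith
    then show ?thesis by (simp add: real_le_rsqrt)
  qed
  ultimately show ?thesis by (intro LIMSEQ_le_const2) auto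
qed

section \<open>Trigonometric polynomials as extremal functions\<close>

text \<open>Restricted to \<open>[0,1]\<close>, because elements of the Sobolev space are undefined elsewhere.\<close>

definition trig_poly :: "int set \<Rightarrow> (int \<Rightarrow> complex) \<Rightarrow> real \<Rightarrow> complex" where
  "trig_poly H c = restrict (\<lambda>x. \<Sum>h\<in>H. c h * trig h x) {0..1}"

lemma deriv01_trig_poly:
  assumes "x \<in> {0..1}"
  shows "deriv01 l (trig_poly H c) x = (\<Sum>h\<in>H. (2 * of_real pi * \<i> * of_int h) ^ l * c h * trig h x)"
    and "(deriv01 l (trig_poly H c) has_vector_derivative
      (\<Sum>h\<in>H. (2 * of_real pi * \<i> * of_int h) ^ Suc l * c h * trig h x)) (at x within {0..1})"
proof -
  let ?D = "\<lambda>l x. \<Sum>h\<in>H. (2 * of_real pi * \<i> * of_int h) ^ l * c h * trig h x"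
  have D: "(?D l has_vector_derivative ?D (Suc l) x) (at x within {0..1})" for l x
  proof -
    have "(?D l has_vector_derivative (\<Sum>h\<in>H. (2 * of_real pi * \<i> * of_int h) ^ l * c h *
        (2 * of_real pi * \<i> * of_int h * trig h x))) (at x within {0..1})"
      by (intro has_vector_derivative_sum has_vector_derivative_mult_right trig_has_vector_derivative)
    then show ?thesis by (simp add: mult_ac)
  qed
  have eq: "\<forall>x\<in>{0..1}. deriv01 l (trig_poly H c) x = ?D l x" for l
  proof (induction l)
    case 0
    then show ?case by (simp add: trig_poly_def)
  next
    case (Suc l)
    show ?case
    proof
      fix x :: real assume x: "x \<in> {0..1}"
      have "(deriv01 l (trig_poly H c) has_vector_derivative ?D (Suc l) x) (at x within {0..1})"
        by (rule has_vector_derivative_transform[OF x _ D]) (use Suc in simp)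
      then show "deriv01 (Suc l) (trig_poly H c) x = ?D (Suc l) x"
        unfolding deriv01_Suc using x by (intro vector_derivative_within_closed_interval) auto
    qed
  qed
  show "deriv01 l (trig_poly H c) x = ?D l x"
    using eq assms by blast
  show "(deriv01 l (trig_poly H c) has_vector_derivative ?D (Suc l) x) (at x within {0..1})"
    by (rule has_vector_derivative_transform[OF assms _ D]) (use eq in simp)
qed

lemma trig_poly_in_periodic_sobolev: "trig_poly H c \<in> periodic_sobolev s"
proof -
  have diff: "deriv01 l (trig_poly H c) differentiable (at x within {0..1})" if "x \<in> {0..1}" for l x
    using deriv01_trig_poly(2)[OF that] by (rule differentiableI_vector)
  have cont: "continuous_on {0..1} (deriv01 l (trig_poly H c))" for l
    using diff differentiable_imp_continuous_within continuous_on_eq_continuous_within by blast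
  have AC: "abs_continuous_on {0..1} (deriv01 l (trig_poly H c))" for l
    using deriv01_has_vector_derivative[OF diff] cont by (rule C1_imp_abs_continuous_on)
  have "deriv01 s (trig_poly H c) \<in> L2_01"
    unfolding L2_01_iff_square_integrable by (rule continuous_imp_square_integrable[OF cont])
  then have "trig_poly H c \<in> sobolev s"
    using diff AC by (auto simp: sobolev_def trig_poly_def)
  moreover have "deriv01 l (trig_poly H c) 0 = deriv01 l (trig_poly H c) 1" for l
    using deriv01_trig_poly(1)[of 0] deriv01_trig_poly(1)[of 1] by simp
  ultimately show ?thesis by (simp add: periodic_sobolev_def)
qed

lemma fourier_int_trig_poly:
  assumes "finite H"
  shows "fourier_int k (trig_poly H c) = (if k \<in> H then c k else 0)"
proof -
  have "fourier_int k (trig_poly H c) = (LINT x|lebesgue_on {0..1}. (\<Sum>h\<in>H. c h * (trig h x * cnj (trig k x))))"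
    unfolding fourier_int_eq
    by (intro Bochner_Integration.integral_cong) (simp_all add: trig_poly_def sum_distrib_right mult.assoc)
  also have "\<dots> = (\<Sum>h\<in>H. LINT x|lebesgue_on {0..1}. c h * (trig h x * cnj (trig k x)))"
    using square_integrable_mult[OF square_integrable_trig square_integrable_cnj[OF square_integrable_trig]]
    by (intro Bochner_Integration.integral_sum) simp
  also have "\<dots> = (\<Sum>h\<in>H. c h * (if h = k then 1 else 0))"
    by (simp add: trig_orthonormal)
  finally show ?thesis using assms by (simp add: mult_delta_right)
qed

text \<open>The derivative of order \<open>s\<close> equals its own Fourier partial sum over \<open>H\<close>, so that the left side of
  the Bessel identity vanishes.\<close>

lemma sob_norm_trig_poly:
  assumes s: "1 \<le> s" and H: "finite H"
  shows "(sob_norm s (trig_poly H c))\<^sup>2 = (\<Sum>h\<in>H. sobolev_weight s h * (cmod (c h))\<^sup>2)"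
proof -
  note ps = trig_poly_in_periodic_sobolev[of H c s]
  let ?D = "deriv01 s (trig_poly H c)"
  have coeff: "fourier_int h ?D = (2 * of_real pi * \<i> * of_int h) ^ s * c h" if "h \<in> H" for h
    using that by (simp add: fourier_int_deriv01[OF ps] fourier_int_trig_poly[OF H])
  have "(LINT x|lebesgue_on {0..1}. (cmod (?D x))\<^sup>2) - (\<Sum>h\<in>H. (cmod (fourier_int h ?D))\<^sup>2)
      = (LINT x|lebesgue_on {0..1}. (cmod (?D x - (\<Sum>h\<in>H. fourier_int h ?D * trig h x)))\<^sup>2)"
    by (rule fourier_Bessel_identity[OF square_integrable_deriv01[OF ps] H, symmetric])
  also have "\<dots> = (LINT x|lebesgue_on {0..1::real}. 0)"
    by (intro Bochner_Integration.integral_cong refl) (simp add: deriv01_trig_poly(1) coeff)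
  finally have "(LINT x|lebesgue_on {0..1}. (cmod (?D x))\<^sup>2)
      = (\<Sum>h\<in>H. (cmod ((2 * of_real pi * \<i> * of_int h) ^ s * c h))\<^sup>2)"
    by (simp add: coeff)
  also have "\<dots> = (\<Sum>h\<in>H. (2 * pi * real_of_int h) ^ (2 * s) * (cmod (c h))\<^sup>2)"
    by (simp only: norm_mult[of "_ ^ s"] power_mult_distrib[of "cmod _"] norm_two_pi_power)
  moreover have "(cmod (fourier_int 0 (trig_poly H c)))\<^sup>2 = (\<Sum>h\<in>H. (if h = 0 then 1 else 0) * (cmod (c h))\<^sup>2)"
    using H by (simp add: fourier_int_trig_poly mult_delta_left)
  ultimately show ?thesis
    unfolding sob_norm_square[OF ps s] sobolev_weight_eq[OF s]
    by (simp add: distrib_right sum.distrib)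
qed

text \<open>The coefficients \<open>1 / r h\<close> give equality in the Cauchy-Schwarz estimate of the error; the factor
  \<open>1 / sqrt (W m)\<close> normalises the Sobolev norm to 1. As \<open>k\<close> is not a frequency of this
  polynomial, its integral against the exponential of frequency \<open>k\<close> is 0, while the quadrature
  formula returns \<open>sqrt (W m)\<close>.\<close>

lemma wc_error_qmc_ge:
  fixes k :: int
  assumes s: "1 \<le> s" and n: "1 \<le> n"
  defines "W \<equiv> \<lambda>m. \<Sum>h\<in>aliases n k m. 1 / sobolev_weight s h"
  shows "ereal (sqrt (W m)) \<le> wc_error s k (qmc n k)"
proof (cases "W m = 0")
  case True
  \<comment> \<open>There is nothing to normalise for an empty block; any element of the ball will do.\<close>
  have "trig_poly {} (\<lambda>_. 0) \<in> periodic_ball s"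
    using trig_poly_in_periodic_sobolev[of "{}" "\<lambda>_. 0" s] sob_norm_trig_poly[OF s, of "{}" "\<lambda>_. 0"]
    by (simp add: periodic_ball_def)
  then have "ereal (cmod (fourier_int k (trig_poly {} (\<lambda>_. 0)) - qmc n k (trig_poly {} (\<lambda>_. 0))))
      \<le> wc_error s k (qmc n k)"
    unfolding wc_error_def by (rule SUP_upper)
  then show ?thesis using True by (auto intro: order_trans[rotated])
next
  case False
  let ?H = "aliases n k m" and ?r = "sobolev_weight s"
  have r: "?r h > 0" for h by (rule sobolev_weight_pos)
  have W: "W m > 0"
    using False r by (simp add: W_def sum_nonneg less_le)
  have Wm: "(\<Sum>h\<in>?H. 1 / ?r h) = W m" by (simp add: W_def)
  define c :: "int \<Rightarrow> complex" where "c h = of_real (1 / (?r h * sqrt (W m)))" for h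
  have "(sob_norm s (trig_poly ?H c))\<^sup>2 = (\<Sum>h\<in>?H. 1 / ?r h * (1 / W m))"
    unfolding sob_norm_trig_poly[OF s finite_aliases] c_def norm_of_real
    using r W by (intro sum.cong refl) (simp add: power2_eq_square abs_mult field_simps)
  also have "\<dots> = 1"
    using W Wm by (simp only: sum_distrib_right[symmetric]) simp
  finally have "sob_norm s (trig_poly ?H c) \<le> 1"
    by (simp add: power2_le_imp_le)
  then have "trig_poly ?H c \<in> periodic_ball s"
    using trig_poly_in_periodic_sobolev by (simp add: periodic_ball_def)
  then have "ereal (cmod (fourier_int k (trig_poly ?H c) - qmc n k (trig_poly ?H c))) \<le> wc_error s k (qmc n k)"
    unfolding wc_error_def by (rule SUP_upper)
  moreover have "fourier_int k (trig_poly ?H c) = 0"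
    using not_in_aliases[OF n] by (simp add: fourier_int_trig_poly)
  moreover have "qmc n k (trig_poly ?H c) = of_real (sqrt (W m))"
  proof -
    have "qmc n k (trig_poly ?H c) = (\<Sum>h \<in> {h \<in> ?H. int n dvd h - k}. c h)"
      by (rule qmc_trig_sum[OF n]) (simp_all add: trig_poly_def)
    also have "{h \<in> ?H. int n dvd h - k} = ?H"
      using aliases_dvd by blast
    also have "(\<Sum>h\<in>?H. c h) = of_real ((\<Sum>h\<in>?H. 1 / ?r h) / sqrt (W m))"
      by (simp add: c_def sum_divide_distrib)
    also have "\<dots> = of_real (sqrt (W m))"
      unfolding Wm using W by (simp add: real_div_sqrt)
    finally show ?thesis .
  qed
  ultimately show ?thesis using W by simp
qed

section \<open>The worst case error as a series\<close>

definition alias_term :: "nat \<Rightarrow> nat \<Rightarrow> int \<Rightarrow> nat \<Rightarrow> real" where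
  "alias_term s n k j = 1 / max 1 ((2 * pi * (real (Suc j) * real n + real_of_int k)) ^ (2 * s))
                  + 1 / max 1 ((2 * pi * (real (Suc j) * real n - real_of_int k)) ^ (2 * s))"

text \<open>The even exponent makes the sign of an alias below \<open>k\<close> irrelevant.\<close>

lemma sum_aliases_eq:
  assumes "1 \<le> n"
  shows "(\<Sum>h\<in>aliases n k m. 1 / sobolev_weight s h) = (\<Sum>j<m. alias_term s n k j)"
  unfolding sum_aliases[OF assms]
proof (intro sum.cong refl)
  fix j
  have "(2 * pi * real_of_int (k - (1 + int j) * int n)) ^ (2 * s)
      = (- (2 * pi * (real (Suc j) * real n - real_of_int k))) ^ (2 * s)"
    by (simp add: algebra_simps)
  also have "\<dots> = (2 * pi * (real (Suc j) * real n - real_of_int k)) ^ (2 * s)"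
    by (rule power_minus_even) simp
  finally show "1 / sobolev_weight s (k + (1 + int j) * int n) + 1 / sobolev_weight s (k - (1 + int j) * int n)
      = alias_term s n k j"
    by (simp add: sobolev_weight_def alias_term_def algebra_simps)
qed

lemma wc_error_qmc:
  assumes s: "1 \<le> s" and n: "1 \<le> n" and sm: "summable (alias_term s n k)"
  shows "wc_error s k (qmc n k) = ereal (sqrt (\<Sum>j. alias_term s n k j))"
proof (rule antisym)
  show "wc_error s k (qmc n k) \<le> ereal (sqrt (\<Sum>j. alias_term s n k j))"
    unfolding wc_error_def
  proof (rule SUP_least)
    fix f assume f: "f \<in> periodic_ball s"
    have "(\<Sum>h\<in>aliases n k m. 1 / sobolev_weight s h) \<le> (\<Sum>j. alias_term s n k j)" for m
      unfolding sum_aliases_eq[OF n] by (intro sum_le_suminf sm) (auto simp: alias_term_def)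
    from qmc_error_le[OF f s n this]
    show "ereal (cmod (fourier_int k f - qmc n k f)) \<le> ereal (sqrt (\<Sum>j. alias_term s n k j))"
      by simp
  qed
  have "(\<lambda>m. ereal (sqrt (\<Sum>j<m. alias_term s n k j))) \<longlonglongrightarrow> ereal (sqrt (\<Sum>j. alias_term s n k j))"
    by (intro tendsto_ereal tendsto_real_sqrt summable_LIMSEQ sm)
  then show "ereal (sqrt (\<Sum>j. alias_term s n k j)) \<le> wc_error s k (qmc n k)"
    by (rule LIMSEQ_le_const2) (use wc_error_qmc_ge[OF s n] sum_aliases_eq[OF n] in auto)
qed

section \<open>Comparison of the error with powers of the number of nodes\<close>

lemma two_pi_power_mono:
  assumes "\<bar>x\<bar> \<le> \<bar>y\<bar>"
  shows "(2 * pi * x) ^ (2 * s) \<le> (2 * pi * y) ^ (2 * s)"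
proof -
  have "\<bar>2 * pi * x\<bar> ^ (2 * s) \<le> \<bar>2 * pi * y\<bar> ^ (2 * s)"
    using assms by (intro power_mono) (simp_all add: abs_mult)
  then show ?thesis by (simp add: power_even_abs)
qed

lemma summable_inverse_squares: "summable (\<lambda>j. 1 / (real j + 1)\<^sup>2)"
  using sums_summable[OF inverse_squares_sums] by (simp add: add.commute)

text \<open>The term \<open>1 / (j + 1)^2\<close> is at most the telescoping difference \<open>1 / j - 1 / (j + 1)\<close> if
  \<open>j > 0\<close>.\<close>

lemma suminf_inverse_squares_le: "(\<Sum>j. 1 / (real j + 1)\<^sup>2) \<le> 2"
proof (rule suminf_le_const[OF summable_inverse_squares])
  have "(\<Sum>j<Suc m. 1 / (real j + 1)\<^sup>2) \<le> 2 - 1 / (real m + 1)" for m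
  proof (induction m)
    case (Suc m)
    have "1 / (real m + 2)\<^sup>2 \<le> 1 / ((real m + 1) * (real m + 2))"
      unfolding power2_eq_square by (intro divide_left_mono mult_right_mono mult_pos_pos) auto
    also have "\<dots> = 1 / (real m + 1) - 1 / (real m + 2)"
      by (simp add: field_simps)
    finally have "1 / (real m + 2)\<^sup>2 \<le> 1 / (real m + 1) - 1 / (real m + 2)" .
    then show ?case using Suc by (simp add: add.commute)
  qed simp
  note le = this
  show "(\<Sum>j<m. 1 / (real j + 1)\<^sup>2) \<le> 2" for m
  proof (cases m)
    case (Suc i)
    have "1 / (real i + 1) \<ge> 0" by simp
    then show ?thesis using le[of i] unfolding Suc by linarith
  qed simp
qed

text \<open>From \<open>j \<ge> 2 |k|\<close> on, the distance of both frequencies from 0 is at least \<open>(j + 1) / 2\<close>.\<close>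

lemma summable_alias_term:
  assumes s: "1 \<le> s" and n: "1 \<le> n"
  shows "summable (alias_term s n k)"
proof (rule summable_comparison_test')
  show "summable (\<lambda>j. 2 * (1 / (real j + 1)\<^sup>2))"
    by (intro summable_mult summable_inverse_squares)
  fix j assume j: "nat (2 * \<bar>k\<bar>) \<le> j"
  have le: "1 / max 1 ((2 * pi * x) ^ (2 * s)) \<le> 1 / (real j + 1)\<^sup>2"
    if x: "real (Suc j) * real n - \<bar>real_of_int k\<bar> \<le> \<bar>x\<bar>" for x
  proof -
    define p where "p = real (Suc j) * real n"
    have "real (Suc j) * 1 \<le> p" unfolding p_def using n by (intro mult_left_mono) auto
    moreover have "2 * \<bar>real_of_int k\<bar> \<le> real j" using j by linarith
    ultimately have "(real j + 1) / 2 \<le> \<bar>x\<bar>" using x unfolding p_def[symmetric] by simp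
    then have "2 * 1 * ((real j + 1) / 2) \<le> 2 * pi * \<bar>x\<bar>"
      using pi_gt3 by (intro mult_mono) auto
    then have "real j + 1 \<le> \<bar>2 * pi * x\<bar>" by (simp add: abs_mult)
    then have "(real j + 1) ^ (2 * s) \<le> \<bar>2 * pi * x\<bar> ^ (2 * s)" by (intro power_mono) auto
    moreover have "(real j + 1) ^ 2 \<le> (real j + 1) ^ (2 * s)" using s by (intro power_increasing) auto
    ultimately have "(real j + 1)\<^sup>2 \<le> max 1 ((2 * pi * x) ^ (2 * s))"
      by (simp add: power_even_abs)
    then show ?thesis by (intro divide_left_mono) auto
  qed
  have "alias_term s n k j \<le> 1 / (real j + 1)\<^sup>2 + 1 / (real j + 1)\<^sup>2"
    unfolding alias_term_def by (intro add_mono le) linarith+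
  then show "norm (alias_term s n k j) \<le> 2 * (1 / (real j + 1)\<^sup>2)"
    by (simp add: alias_term_def)
qed

text \<open>For \<open>n \<le> |k|\<close> one of the two nearest aliases, \<open>k - n\<close> or \<open>k + n\<close>, is at most as large as \<open>k\<close> in
  absolute value. It alone contributes at least the square of the initial error, and the other one
  makes the inequality strict.\<close>

lemma init_error_less_wc_error_qmc:
  assumes s: "1 \<le> s" and n: "1 \<le> n" and k: "int n \<le> \<bar>k\<bar>"
  shows "init_error s k < wc_error s k (qmc n k)"
proof -
  have nk: "\<bar>real n - \<bar>real_of_int k\<bar>\<bar> \<le> \<bar>real_of_int k\<bar>" using k by linarith
  have le: "1 / sobolev_weight s k \<le> 1 / max 1 ((2 * pi * x) ^ (2 * s))"
    if "\<bar>x\<bar> \<le> \<bar>real_of_int k\<bar>" for x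
    using two_pi_power_mono[OF that, of s] unfolding sobolev_weight_def
    by (intro divide_left_mono) auto
  have pos: "0 < 1 / max 1 ((2 * pi * x) ^ (2 * s))" for x :: real
    by (simp add: less_max_iff_disj)
  have "1 / sobolev_weight s k < 1 / max 1 ((2 * pi * (real n + real_of_int k)) ^ (2 * s))
      + 1 / max 1 ((2 * pi * (real n - real_of_int k)) ^ (2 * s))"
  proof (cases "k \<ge> 0")
    case True
    then have "\<bar>real n - real_of_int k\<bar> \<le> \<bar>real_of_int k\<bar>" using nk by simp
    from le[OF this] pos[of "real n + real_of_int k"] show ?thesis by linarith
  next
    case False
    then have "\<bar>real n + real_of_int k\<bar> \<le> \<bar>real_of_int k\<bar>" using nk by simp
    from le[OF this] pos[of "real n - real_of_int k"] show ?thesis by linarith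
  qed
  also have "\<dots> = alias_term s n k 0" by (simp add: alias_term_def)
  also have "\<dots> = (\<Sum>j<1. alias_term s n k j)" by simp
  also have "\<dots> \<le> (\<Sum>j. alias_term s n k j)"
    by (intro sum_le_suminf summable_alias_term s n) (auto simp: alias_term_def)
  finally have "ereal (sqrt (1 / sobolev_weight s k)) < wc_error s k (qmc n k)"
    by (simp add: wc_error_qmc[OF s n summable_alias_term[OF s n]])
  with init_error_le[OF s] show ?thesis by (rule le_less_trans)
qed

text \<open>For \<open>n > |k|\<close> no alias is 0, hence each weight is the power of \<open>2 \<pi> h\<close>.\<close>

lemma alias_term_eq:
  assumes "\<bar>k\<bar> < int n"
  shows "alias_term s n k j = 1 / (2 * pi * (real (Suc j) * real n + real_of_int k)) ^ (2 * s)
     + 1 / (2 * pi * (real (Suc j) * real n - real_of_int k)) ^ (2 * s)"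
proof -
  have "real (Suc j) * real n \<ge> 1 * real n" by (intro mult_right_mono) auto
  moreover have "real n \<ge> 1 + \<bar>real_of_int k\<bar>" using assms by linarith
  ultimately have "1 \<le> \<bar>real (Suc j) * real n + real_of_int k\<bar>" "1 \<le> \<bar>real (Suc j) * real n - real_of_int k\<bar>"
    by linarith+
  then show ?thesis
    unfolding alias_term_def by (simp only: one_le_two_pi_power max_absorb2)
qed

text \<open>Both frequencies in the term of index \<open>j\<close> are at least \<open>(j + 1) * (n - |k|)\<close> in absolute value.
  Factoring out the power of \<open>n - |k|\<close> leaves twice the series of inverse squares, which is at
  most 4, the square of the constant 2 in the bound.\<close>

lemma suminf_alias_term_le:
  assumes s: "1 \<le> s" and k: "\<bar>k\<bar> < int n"
  shows "(\<Sum>j. alias_term s n k j) \<le> (2 / (2 * pi) ^ s * (1 / (real n - real_of_int \<bar>k\<bar>) ^ s))\<^sup>2"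
proof -
  define d where "d = real n - real_of_int \<bar>k\<bar>"
  have d: "d > 0" using k by (simp add: d_def)
  have n: "1 \<le> n" using k by simp
  define C where "C = 1 / (2 * pi * d) ^ (2 * s)"
  have C: "C > 0" using d by (simp add: C_def)
  have le: "1 / (2 * pi * x) ^ (2 * s) \<le> C * (1 / (real j + 1)\<^sup>2)"
    if x: "real (Suc j) * real n - \<bar>real_of_int k\<bar> \<le> x" for j x
  proof -
    have "\<bar>real_of_int k\<bar> * 1 \<le> \<bar>real_of_int k\<bar> * real (Suc j)" by (intro mult_left_mono) auto
    then have "real (Suc j) * real n - real (Suc j) * \<bar>real_of_int k\<bar> \<le> x"
      using x by (simp only: mult.commute[of "real (Suc j)"] mult_1_right)
    then have "(real j + 1) * d \<le> x" by (simp add: d_def algebra_simps)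
    then have "2 * pi * ((real j + 1) * d) \<le> 2 * pi * x" by simp
    then have "(2 * pi * ((real j + 1) * d)) ^ (2 * s) \<le> (2 * pi * x) ^ (2 * s)"
      using d by (intro power_mono) auto
    moreover have "(2 * pi * ((real j + 1) * d)) ^ (2 * s) = (2 * pi * d) ^ (2 * s) * (real j + 1) ^ (2 * s)"
      by (simp add: power_mult_distrib[symmetric] mult_ac)
    moreover have "(2 * pi * d) ^ (2 * s) * (real j + 1)\<^sup>2 \<le> (2 * pi * d) ^ (2 * s) * (real j + 1) ^ (2 * s)"
      using d s by (intro mult_left_mono power_increasing) auto
    ultimately have "(2 * pi * d) ^ (2 * s) * (real j + 1)\<^sup>2 \<le> (2 * pi * x) ^ (2 * s)" by linarith
    moreover have "0 < (2 * pi * d) ^ (2 * s) * (real j + 1)\<^sup>2" using d by simp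
    ultimately have "1 / (2 * pi * x) ^ (2 * s) \<le> 1 / ((2 * pi * d) ^ (2 * s) * (real j + 1)\<^sup>2)"
      by (intro frac_le) auto
    then show ?thesis by (simp add: C_def)
  qed
  have "alias_term s n k j \<le> C * (1 / (real j + 1)\<^sup>2) + C * (1 / (real j + 1)\<^sup>2)" for j
    unfolding alias_term_eq[OF k] by (intro add_mono le) linarith+
  then have "(\<Sum>j. alias_term s n k j) \<le> (\<Sum>j. 2 * C * (1 / (real j + 1)\<^sup>2))"
    by (intro suminf_le summable_alias_term s n summable_mult summable_inverse_squares) simp
  also have "\<dots> = 2 * C * (\<Sum>j. 1 / (real j + 1)\<^sup>2)"
    by (rule suminf_mult[OF summable_inverse_squares])
  also have "\<dots> \<le> 2 * C * 2"
    using C suminf_inverse_squares_le by (intro mult_left_mono) auto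
  also have "\<dots> = (2 / (2 * pi) ^ s * (1 / d ^ s))\<^sup>2"
    by (simp add: C_def power_mult_distrib power_divide power_mult[symmetric] mult.commute)
  finally show ?thesis by (simp add: d_def)
qed

lemma wc_error_qmc_le:
  assumes s: "1 \<le> s" and k: "\<bar>k\<bar> < int n"
  shows "wc_error s k (qmc n k) \<le> ereal (2 / (2 * pi) ^ s * (1 / (real n - real_of_int \<bar>k\<bar>) ^ s))"
proof -
  have n: "1 \<le> n" using k by simp
  have "0 \<le> 2 / (2 * pi) ^ s * (1 / (real n - real_of_int \<bar>k\<bar>) ^ s)"
    using k by (intro mult_nonneg_nonneg divide_nonneg_nonneg zero_le_power) auto
  then show ?thesis
    using suminf_alias_term_le[OF s k]
    by (simp only: wc_error_qmc[OF s n summable_alias_term[OF s n]] ereal_less_eq real_le_lsqrt)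
qed

text \<open>The hypothesis on \<open>n\<close> says precisely that \<open>\<alpha> * (n + |k|) < n - |k|\<close>.\<close>

lemma wc_error_qmc_less:
  fixes \<alpha> :: real
  assumes s: "1 \<le> s" and \<alpha>: "0 < \<alpha>" "\<alpha> < 1"
    and n: "real n > (1 + \<alpha>) / (1 - \<alpha>) * real_of_int \<bar>k\<bar>"
  shows "wc_error s k (qmc n k) < ereal (2 / (2 * pi * \<alpha>) ^ s * (1 / (real n + real_of_int \<bar>k\<bar>) ^ s))"
proof -
  have "(1 + \<alpha>) * real_of_int \<bar>k\<bar> < (1 - \<alpha>) * real n"
    using n \<alpha> by (simp add: field_simps)
  then have lt: "\<alpha> * (real n + real_of_int \<bar>k\<bar>) < real n - real_of_int \<bar>k\<bar>"
    by (simp add: algebra_simps)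
  have "0 \<le> (1 + \<alpha>) / (1 - \<alpha>) * real_of_int \<bar>k\<bar>" using \<alpha> by simp
  then have n0: "0 < real n" using n by linarith
  then have pos: "0 < \<alpha> * (real n + real_of_int \<bar>k\<bar>)" using \<alpha> by (intro mult_pos_pos) auto
  then have k: "\<bar>k\<bar> < int n" using lt by linarith
  have "(\<alpha> * (real n + real_of_int \<bar>k\<bar>)) ^ s < (real n - real_of_int \<bar>k\<bar>) ^ s"
    using lt pos s by (intro power_strict_mono) auto
  then have "1 / (real n - real_of_int \<bar>k\<bar>) ^ s < 1 / (\<alpha> * (real n + real_of_int \<bar>k\<bar>)) ^ s"
    using lt pos \<alpha> by (intro divide_strict_left_mono mult_pos_pos zero_less_power) auto
  then have "2 / (2 * pi) ^ s * (1 / (real n - real_of_int \<bar>k\<bar>) ^ s)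
      < 2 / (2 * pi) ^ s * (1 / (\<alpha> * (real n + real_of_int \<bar>k\<bar>)) ^ s)"
    by (intro mult_strict_left_mono) auto
  also have "\<dots> = 2 / (2 * pi * \<alpha>) ^ s * (1 / (real n + real_of_int \<bar>k\<bar>) ^ s)"
    by (simp add: power_mult_distrib)
  finally show ?thesis
    unfolding less_ereal.simps(1)[symmetric] by (rule le_less_trans[OF wc_error_qmc_le[OF s k]])
qed



theorem theorem4:
  fixes s n :: nat and k :: int
  assumes "1 \<le> s" and "1 \<le> n"
  shows
    "(summable (\<lambda>j. 1 / max 1 ((2 * pi * (real (Suc j) * real n + real_of_int k)) ^ (2 * s))
                  + 1 / max 1 ((2 * pi * (real (Suc j) * real n - real_of_int k)) ^ (2 * s))) \<and>
      wc_error s k (qmc n k) =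
        ereal (sqrt (\<Sum>j. 1 / max 1 ((2 * pi * (real (Suc j) * real n + real_of_int k)) ^ (2 * s))
                       + 1 / max 1 ((2 * pi * (real (Suc j) * real n - real_of_int k)) ^ (2 * s)))))
     \<and> (int n \<le> \<bar>k\<bar> \<longrightarrow> wc_error s k (qmc n k) > init_error s k)
     \<and> (int n > \<bar>k\<bar> \<longrightarrow>
         summable (\<lambda>j. 1 / (2 * pi * (real (Suc j) * real n + real_of_int k)) ^ (2 * s)
                     + 1 / (2 * pi * (real (Suc j) * real n - real_of_int k)) ^ (2 * s)) \<and>
         wc_error s k (qmc n k) =
           ereal (sqrt (\<Sum>j. 1 / (2 * pi * (real (Suc j) * real n + real_of_int k)) ^ (2 * s)
                          + 1 / (2 * pi * (real (Suc j) * real n - real_of_int k)) ^ (2 * s))) \<and>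
         wc_error s k (qmc n k) \<le>
           ereal (2 / (2 * pi) ^ s * (1 / (real n - real_of_int \<bar>k\<bar>) ^ s)))
     \<and> (\<forall>\<alpha>::real. 0 < \<alpha> \<and> \<alpha> < 1 \<and> real n > (1 + \<alpha>) / (1 - \<alpha>) * real_of_int \<bar>k\<bar> \<longrightarrow>
         wc_error s k (qmc n k) <
           ereal (2 / (2 * pi * \<alpha>) ^ s * (1 / (real n + real_of_int \<bar>k\<bar>) ^ s)))"
proof -
  note sm = summable_alias_term[OF assms, of k]
  note error = wc_error_qmc[OF assms sm]
  have eq: "alias_term s n k = (\<lambda>j. 1 / (2 * pi * (real (Suc j) * real n + real_of_int k)) ^ (2 * s)
      + 1 / (2 * pi * (real (Suc j) * real n - real_of_int k)) ^ (2 * s))" if "int n > \<bar>k\<bar>"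
    using alias_term_eq[OF that] by (rule ext)
  show ?thesis
  proof (intro conjI impI allI)
    assume k: "int n > \<bar>k\<bar>"
    show "summable (\<lambda>j. 1 / (2 * pi * (real (Suc j) * real n + real_of_int k)) ^ (2 * s)
        + 1 / (2 * pi * (real (Suc j) * real n - real_of_int k)) ^ (2 * s))"
      using sm unfolding eq[OF k] .
    show "wc_error s k (qmc n k) =
        ereal (sqrt (\<Sum>j. 1 / (2 * pi * (real (Suc j) * real n + real_of_int k)) ^ (2 * s)
          + 1 / (2 * pi * (real (Suc j) * real n - real_of_int k)) ^ (2 * s)))"
      using error unfolding eq[OF k] .
    show "wc_error s k (qmc n k) \<le> ereal (2 / (2 * pi) ^ s * (1 / (real n - real_of_int \<bar>k\<bar>) ^ s))"
      by (rule wc_error_qmc_le[OF assms(1) k])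
  next
    assume "int n \<le> \<bar>k\<bar>"
    then show "init_error s k < wc_error s k (qmc n k)"
      by (rule init_error_less_wc_error_qmc[OF assms])
  next
    fix \<alpha> :: real
    assume "0 < \<alpha> \<and> \<alpha> < 1 \<and> real n > (1 + \<alpha>) / (1 - \<alpha>) * real_of_int \<bar>k\<bar>"
    then show "wc_error s k (qmc n k) <
        ereal (2 / (2 * pi * \<alpha>) ^ s * (1 / (real n + real_of_int \<bar>k\<bar>) ^ s))"
      using wc_error_qmc_less[OF assms(1)] by blast
  qed (use sm error in \<open>simp_all only: alias_term_def[abs_def]\<close>)
qed

end
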